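(* Let $X$ be a Banach space and $(\mathcal A(t))_{t\in\mathbb R}$ a family of linear operators on $X$ satisfying: (P1) $\mathcal D=\mathcal D(\mathcal A(t))$ is independent of $t$; (P2) each $\mathcal A(t)$ is sectorial and generates an analytic semigroup, the resolvent $R(z,\mathcal A(t))$ exists for all $z\in\mathbb C$ with $\mathrm{Re}\,z\ge0$ with $\|R(z,\mathcal A(t))\|\le M_0/(|z|+1)$ for some $M_0\ge1$ independent of $t$, and $\|e^{\tau\mathcal A(t)}\|\le e^{\omega\tau}$ for all $\tau\ge0$, $t\in\mathbb R$; (P3) there are $L\ge0$, $0<\theta\le1$ with $\|(\mathcal A(t)-\mathcal A(s))\mathcal A(0)^{-1}\|\le L|t-s|^\theta$ for all $t,s$; and (H) there are $0\le\alpha<\beta$ and $C>0$ such that $\|(\mathcal A(t)-\mathcal A(s))x\|\le C|t-s|^\beta\|\mathcal A(\tau)x\|^\alpha\|x\|^{1-\alpha}$ for all $x\in\mathcal D$ and all $s\le\tau\le t$. Let $\mathcal U(t,s)$ be the evolution family solving $u'(t)=\mathcal A(t)u(t)$, with $\|\mathcal U(t,s)\|\le e^{\omega(t-s)}$. Then for every $T>0$ there is $C(T)$ such that for all integers $M\ge1$, with $\Delta t=T/M$, $$\Big\|\mathcal U(T,0)-\prod_{k=0}^{M-1}e^{\Delta t\mathcal A(k\Delta t)}\Big\|_X\le C(T)(\Delta t)^{\beta-\alpha}.$$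
   Context: An evolution family solving the non-autonomous Cauchy problem $u'(t)=\mathcal A(t)u(t)$, $u(s)=x$, is a family of bounded operators $\mathcal U(t,s)$, $t\ge s$, with $\mathcal U(t,r)\mathcal U(r,s)=\mathcal U(t,s)$, $\mathcal U(t,t)=\mathrm{Id}$, strongly continuous in $(t,s)$, such that $t\mapsto\mathcal U(t,s)x$ is the classical solution for $x$ in a dense subspace. Products are ordered $\prod_{k=0}^{M-1}Q_k:=Q_{M-1}\cdots Q_0$. *)

theory Defs
  imports "HOL-Analysis.Analysis"
begin

text \<open>HOL-Analysis has no class of complex normed vector spaces. A complex Banach space
is modelled as a real Banach space of type 'a together with a bounded real-linear
operator J (multiplication by i) with J (J x) = -x and such that the induced complex
scalar multiplication is compatible with the norm.\<close>

definition csmult :: "('a::real_normed_vector \<Rightarrow>\<^sub>L 'a) \<Rightarrow> complex \<Rightarrow> 'a \<Rightarrow> 'a" where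
  "csmult J z x = Re z *\<^sub>R x + Im z *\<^sub>R blinfun_apply J x"

definition complex_structure :: "('a::real_normed_vector \<Rightarrow>\<^sub>L 'a) \<Rightarrow> bool" where
  "complex_structure J \<longleftrightarrow> (\<forall>x. J (J x) = - x) \<and> (\<forall>z x. norm (csmult J z x) = cmod z * norm x)"

definition lin_op :: "('a::real_normed_vector \<Rightarrow>\<^sub>L 'a) \<Rightarrow> 'a set \<Rightarrow> ('a \<Rightarrow> 'a) \<Rightarrow> bool" where
  "lin_op J D A \<longleftrightarrow> 0 \<in> D \<and> (\<forall>x\<in>D. \<forall>y\<in>D. x + y \<in> D) \<and> (\<forall>z. \<forall>x\<in>D. csmult J z x \<in> D)
     \<and> (\<forall>x\<in>D. \<forall>y\<in>D. A (x + y) = A x + A y) \<and> (\<forall>z. \<forall>x\<in>D. A (csmult J z x) = csmult J z (A x))"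

definition resolvent_op :: "('a::real_normed_vector \<Rightarrow>\<^sub>L 'a) \<Rightarrow> 'a set \<Rightarrow> ('a \<Rightarrow> 'a) \<Rightarrow> complex \<Rightarrow> ('a \<Rightarrow>\<^sub>L 'a) \<Rightarrow> bool" where
  "resolvent_op J D A z R \<longleftrightarrow>
     (\<forall>y. R y \<in> D \<and> csmult J z (R y) - A (R y) = y) \<and> (\<forall>x\<in>D. R (csmult J z x - A x) = x)"

text \<open>Sectorial operator (Lunardi): there are \<omega>0 \<in> \<real>, \<phi> \<in> (\<pi>/2, \<pi>) and M > 0 such that
the sector {z \<noteq> \<omega>0. |arg (z - \<omega>0)| < \<phi>} is contained in the resolvent set and
||R(z,A)|| \<le> M / |z - \<omega>0| there.\<close>

definition sectorial :: "('a::real_normed_vector \<Rightarrow>\<^sub>L 'a) \<Rightarrow> 'a set \<Rightarrow> ('a \<Rightarrow> 'a) \<Rightarrow> bool" where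
  "sectorial J D A \<longleftrightarrow> (\<exists>\<omega>0::real. \<exists>\<phi> M::real. pi / 2 < \<phi> \<and> \<phi> < pi \<and> M > 0 \<and>
     (\<forall>z. z \<noteq> complex_of_real \<omega>0 \<and> \<bar>Arg (z - complex_of_real \<omega>0)\<bar> < \<phi> \<longrightarrow>
        (\<exists>R. resolvent_op J D A z R \<and> norm R \<le> M / cmod (z - complex_of_real \<omega>0))))"

definition C0_semigroup :: "(real \<Rightarrow> ('a::real_normed_vector \<Rightarrow>\<^sub>L 'a)) \<Rightarrow> bool" where
  "C0_semigroup S \<longleftrightarrow> S 0 = id_blinfun \<and> (\<forall>a\<ge>0. \<forall>b\<ge>0. S (a + b) = S a o\<^sub>L S b)
     \<and> (\<forall>x. continuous_on {0..} (\<lambda>\<tau>. blinfun_apply (S \<tau>) x))"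

definition generates :: "'a set \<Rightarrow> ('a::real_normed_vector \<Rightarrow> 'a) \<Rightarrow> (real \<Rightarrow> ('a \<Rightarrow>\<^sub>L 'a)) \<Rightarrow> bool" where
  "generates D A S \<longleftrightarrow> C0_semigroup S
     \<and> D = {x. \<exists>y. ((\<lambda>h. (1 / h) *\<^sub>R (S h x - x)) \<longlongrightarrow> y) (at_right 0)}
     \<and> (\<forall>x\<in>D. ((\<lambda>h. (1 / h) *\<^sub>R (S h x - x)) \<longlongrightarrow> A x) (at_right 0))"

definition classical_solution :: "'a set \<Rightarrow> (real \<Rightarrow> 'a \<Rightarrow> 'a::real_normed_vector) \<Rightarrow> real \<Rightarrow> 'a \<Rightarrow> (real \<Rightarrow> 'a) \<Rightarrow> bool" where
  "classical_solution D A s x u \<longleftrightarrow> u s = x \<and> continuous_on {s..} u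
     \<and> (\<forall>t>s. u t \<in> D \<and> (u has_vector_derivative A t (u t)) (at t))"

definition evolution_family :: "'a set \<Rightarrow> (real \<Rightarrow> 'a \<Rightarrow> 'a::real_normed_vector) \<Rightarrow> (real \<Rightarrow> real \<Rightarrow> ('a \<Rightarrow>\<^sub>L 'a)) \<Rightarrow> bool" where
  "evolution_family D A U \<longleftrightarrow>
     (\<forall>s r t. s \<le> r \<and> r \<le> t \<longrightarrow> U t r o\<^sub>L U r s = U t s)
   \<and> (\<forall>t. U t t = id_blinfun)
   \<and> (\<forall>x. continuous_on {(t, s). s \<le> t} (\<lambda>(t, s). blinfun_apply (U t s) x))
   \<and> (\<exists>Y. subspace Y \<and> closure Y = UNIV \<and>
        (\<forall>s. \<forall>x\<in>Y. classical_solution D A s x (\<lambda>t. blinfun_apply (U t s) x)))"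

primrec prodL :: "(nat \<Rightarrow> ('a::real_normed_vector \<Rightarrow>\<^sub>L 'a)) \<Rightarrow> nat \<Rightarrow> ('a \<Rightarrow>\<^sub>L 'a)" where
  "prodL Q 0 = id_blinfun"
| "prodL Q (Suc n) = Q n o\<^sub>L prodL Q n"

end

theory Submission
  imports Defs
begin

text \<open>
On one step \<open>[t, t + h]\<close> the solution \<open>u\<close> is compared with the orbit \<open>v(\<tau>) = exp((\<tau> - t) A(t)) u(t)\<close>
of the frozen semigroup. Their difference satisfies \<open>w' = A(\<tau>) w + (A(\<tau>) - A(t)) v(\<tau>)\<close>, and since all
semigroups are exponentially bounded with constant one, \<open>\<parallel>w\<parallel>\<close> obeys a scalar Dini inequality. Hypothesis
(H) and the smoothing estimate \<open>\<parallel>A(t) exp(\<sigma> A(t))\<parallel> \<le> K / \<sigma>\<close> bound the inhomogeneity by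
\<open>const * (\<tau> - t) powr (\<beta> - \<alpha>)\<close>; hence the local error is \<open>O(h powr (1 + \<beta> - \<alpha>))\<close>, and the local errors are summed.
If \<open>\<alpha> \<ge> 1\<close> then \<open>\<beta> > 1\<close> and (H) forces \<open>A\<close> to be constant in time.

The smoothing estimate, uniform in \<open>t\<close>, is obtained without contour integrals: \<open>exp(\<sigma> A)\<close> is the
limit of \<open>(\<lambda> R(\<lambda>))^n\<close> with \<open>\<lambda> = n / \<sigma>\<close>, and \<open>A R(\<lambda>)^n\<close> is a Taylor coefficient of \<open>A R(z)^3\<close> at
\<open>\<lambda>\<close>, which is estimated by averaging over roots of unity on a circle inside the right half plane.
\<close>

section \<open>One-sided differential inequalities and roots of unity\<close>

text \<open>Continuation argument: the points of \<open>{c..b}\<close> at which \<open>f\<close>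
  lies below the comparison function form a compact set, and its maximum must be \<open>b\<close>,
  because \<open>step\<close> at a smaller maximum would carry the bound further to the
  right.\<close>

lemma right_dini_gronwall:
  fixes f :: "real \<Rightarrow> real"
  assumes "a \<le> b" "0 \<le> \<omega>" "0 \<le> g" and cont: "continuous_on {a..b} f"
    and step: "\<And>x \<epsilon>. a < x \<Longrightarrow> x < b \<Longrightarrow> \<epsilon> > 0 \<Longrightarrow>
      \<forall>\<^sub>F s in at_right 0. f (x + s) \<le> exp (\<omega> * s) * f x + s * (g + \<epsilon>)"
  shows "f b \<le> exp (\<omega> * (b - a)) * (f a + (b - a) * g)"
proof (cases "a = b")
  case False
  with \<open>a \<le> b\<close> have "a < b" by simp
  define \<phi> where "\<phi> c x = exp (\<omega> * (x - c)) * (f c + (x - c) * (g + (c - a)))" for c x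
  have bound: "f b \<le> \<phi> c b" if c: "a < c" "c < b" for c
  proof -
    define K where "K = {x \<in> {c..b}. f x \<le> \<phi> c x}"
    have cc: "continuous_on {c..b} f" by (rule continuous_on_subset[OF cont]) (use c in auto)
    have cp: "continuous_on {c..b} (\<phi> c)" unfolding \<phi>_def by (intro continuous_intros)
    have "closed K" unfolding K_def by (intro continuous_on_closed_Collect_le cc cp closed_atLeastAtMost)
    moreover have "bounded K" by (rule bounded_subset[of "{c..b}"]) (auto simp: K_def)
    ultimately have "compact K" by (simp add: compact_eq_bounded_closed)
    moreover have "c \<in> K" using c by (auto simp: K_def \<phi>_def)
    ultimately obtain m where m: "m \<in> K" "\<And>x. x \<in> K \<Longrightarrow> x \<le> m"
      using compact_attains_sup[of K] by blast
    have "m = b"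
    proof (rule ccontr)
      assume "m \<noteq> b"
      with m have mb: "c \<le> m" "m < b" by (auto simp: K_def)
      have "\<forall>\<^sub>F s in at_right 0. f (m + s) \<le> exp (\<omega> * s) * f m + s * (g + (c - a))"
        using mb c by (intro step) auto
      moreover have "\<forall>\<^sub>F s in at_right 0. 0 < s \<and> s < b - m"
        using mb by (auto simp: eventually_at_right_field intro!: exI[of _ "b - m"])
      ultimately have "\<forall>\<^sub>F s in at_right 0. 0 < s \<and> s < b - m \<and> f (m + s) \<le> exp (\<omega> * s) * f m + s * (g + (c - a))"
        by eventually_elim auto
      then obtain s where s: "0 < s" "s < b - m" "f (m + s) \<le> exp (\<omega> * s) * f m + s * (g + (c - a))"
        using eventually_happens[of _ "at_right (0::real)"] by (metis (mono_tags, lifting) trivial_limit_at_right_real)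
      have "exp (\<omega> * s) * f m \<le> exp (\<omega> * s) * \<phi> c m" using m by (simp add: K_def)
      \<comment> \<open>Enlarging the increment by a factor at least one makes the two terms add up
        to exactly \<open>\<phi> c (m + s)\<close>.\<close>
      moreover have "s * (g + (c - a)) \<le> exp (\<omega> * (m + s - c)) * (s * (g + (c - a)))"
      proof -
        have "1 \<le> exp (\<omega> * (m + s - c))" using \<open>0 \<le> \<omega>\<close> mb s by simp
        then show ?thesis using \<open>0 \<le> g\<close> c s by (intro mult_left_mono[of 1, of _ "s * (g + (c - a))", simplified mult.commute[of "s * (g + (c - a))"] mult_1]) auto
      qed
      moreover have "exp (\<omega> * s) * \<phi> c m + exp (\<omega> * (m + s - c)) * (s * (g + (c - a))) = \<phi> c (m + s)"
      proof -
        have "exp (\<omega> * (m + s - c)) = exp (\<omega> * s) * exp (\<omega> * (m - c))"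
          by (simp add: exp_add[symmetric] algebra_simps)
        then show ?thesis unfolding \<phi>_def by (simp only: ring_distribs mult_ac diff_conv_add_uminus add_ac)
      qed
      ultimately have "f (m + s) \<le> \<phi> c (m + s)" using s by linarith
      then have "m + s \<in> K" using mb s by (auto simp: K_def)
      then show False using m(2)[of "m + s"] s by simp
    qed
    then show ?thesis using m by (simp add: K_def)
  qed
  have "(f \<longlongrightarrow> f a) (at_right a)"
    using cont \<open>a < b\<close> by (simp add: continuous_on_Icc_at_rightD)
  then have "((\<lambda>c. \<phi> c b) \<longlongrightarrow> exp (\<omega> * (b - a)) * (f a + (b - a) * (g + (a - a)))) (at_right a)"
    unfolding \<phi>_def by (intro tendsto_intros)
  moreover have "\<forall>\<^sub>F c in at_right a. f b \<le> \<phi> c b"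
    using \<open>a < b\<close> bound by (auto simp: eventually_at_right_field intro!: exI[of _ b])
  ultimately show ?thesis
    using tendsto_lowerbound[of _ _ "at_right a" "f b"] by (simp add: trivial_limit_at_right_real)
qed (use assms in simp)

text \<open>Mean value inequality for one-sided derivatives: the case \<omega> = 0 of the previous
  lemma, applied to the distance from \<open>p a\<close>.\<close>

lemma right_derivative_bound:
  fixes p :: "real \<Rightarrow> 'a::real_normed_vector"
  assumes "a \<le> b" "0 \<le> g" and cont: "continuous_on {a..b} p"
    and deriv: "\<And>x. a < x \<Longrightarrow> x < b \<Longrightarrow> ((\<lambda>s. (1 / s) *\<^sub>R (p (x + s) - p x)) \<longlongrightarrow> p' x) (at_right 0)"
    and bound: "\<And>x. a < x \<Longrightarrow> x < b \<Longrightarrow> norm (p' x) \<le> g"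
  shows "norm (p b - p a) \<le> (b - a) * g"
proof -
  have "norm (p b - p a) \<le> exp (0 * (b - a)) * (norm (p a - p a) + (b - a) * g)"
  proof (rule right_dini_gronwall)
    show "continuous_on {a..b} (\<lambda>x. norm (p x - p a))" by (intro continuous_intros cont)
    fix x \<epsilon> :: real assume x: "a < x" "x < b" and "\<epsilon> > 0"
    have "((\<lambda>s. norm ((1 / s) *\<^sub>R (p (x + s) - p x))) \<longlongrightarrow> norm (p' x)) (at_right 0)"
      by (intro tendsto_norm deriv x)
    then have "\<forall>\<^sub>F s in at_right 0. norm ((1 / s) *\<^sub>R (p (x + s) - p x)) < g + \<epsilon>"
      using bound[OF x] \<open>\<epsilon> > 0\<close> by (intro order_tendstoD(2)) auto
    moreover have "\<forall>\<^sub>F s::real in at_right 0. 0 < s" by (rule eventually_at_right_less)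
    ultimately show "\<forall>\<^sub>F s in at_right 0. norm (p (x + s) - p a) \<le> exp (0 * s) * norm (p x - p a) + s * (g + \<epsilon>)"
    proof eventually_elim
      case (elim s)
      then have "norm (p (x + s) - p x) / s < g + \<epsilon>" by simp
      then have "norm (p (x + s) - p x) \<le> s * (g + \<epsilon>)" using elim(2) by (simp add: pos_divide_less_eq mult.commute)
      moreover have "norm (p (x + s) - p a) \<le> norm (p x - p a) + norm (p (x + s) - p x)"
        using norm_triangle_ineq[of "p x - p a" "p (x + s) - p x"] by simp
      ultimately show ?case by simp
    qed
  qed (use assms in auto)
  then show ?thesis by simp
qed

section \<open>Discrete averages over roots of unity\<close>

lemma cmod_root_of_unity: "\<zeta> ^ N = (1::complex) \<Longrightarrow> N > 0 \<Longrightarrow> cmod \<zeta> = 1"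
  by (metis norm_ge_zero norm_one norm_power one_power2 power_eq_imp_eq_base power_one zero_le_one)

text \<open>Discrete orthogonality, the substitute for integrating powers over a circle. If
  \<open>N\<close> does not divide \<open>k\<close>, the summands are the powers of an
  \<open>N\<close>-th root of unity other than 1, and the geometric sum vanishes.\<close>

lemma sum_roots_of_unity_power:
  fixes N k :: nat
  assumes "N > 0"
  shows "(\<Sum>\<zeta>::complex | \<zeta> ^ N = 1. \<zeta> ^ k) = (if N dvd k then of_nat N else (0::complex))"
proof (cases "N dvd k")
  case True
  then obtain l where "k = N * l" by (elim dvdE)
  then have "(\<Sum>\<zeta>::complex | \<zeta> ^ N = 1. \<zeta> ^ k) = (\<Sum>\<zeta>::complex | \<zeta> ^ N = 1. 1)"
    by (intro sum.cong) (auto simp: power_mult)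
  then show ?thesis using True card_roots_unity_eq[OF assms] by simp
next
  case False
  define x where "x = cis (2 * pi * real k / real N)"
  have "(\<Sum>\<zeta>::complex | \<zeta> ^ N = 1. \<zeta> ^ k) = (\<Sum>j<N. cis (2 * pi * real j / real N) ^ k)"
    by (rule sum.reindex_bij_betw[symmetric]) (rule Complex.bij_betw_roots_unity[OF assms])
  also have "\<dots> = (\<Sum>j<N. x ^ j)"
    unfolding x_def Complex.DeMoivre by (intro sum.cong refl arg_cong[where f = cis]) simp
  also have "x \<noteq> 1"
  proof
    assume "x = 1"
    then have "cos (2 * pi * real k / real N) = 1" by (simp add: x_def complex_eq_iff)
    then obtain n :: int where "2 * pi * real k / real N = of_int n * 2 * pi"
      using cos_one_2pi_int by blast
    then have "real k = of_int n * real N" using assms by (simp add: field_simps)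
    then have "int k = n * int N" by (metis of_int_eq_iff of_int_mult of_int_of_nat_eq)
    then show False using False by (metis dvd_triv_right int_dvd_int_iff)
  qed
  then have "(\<Sum>j<N. x ^ j) = (x ^ N - 1) / (x - 1)" by (rule geometric_sum)
  also have "x ^ N = 1"
  proof -
    have "x ^ N = cis (real k * (2 * pi))" using assms by (simp add: x_def Complex.DeMoivre mult_ac)
    also have "\<dots> = 1" using cis_multiple_2pi[of "real k"] by (simp add: mult_ac)
    finally show ?thesis .
  qed
  finally show ?thesis using False by simp
qed

text \<open>The partial fraction expansion of \<open>1 / ((l + r \<zeta>) (l + r / \<zeta>))\<close> reduces the sum
to a geometric one.\<close>

lemma sum_inverse_norm_square:
  fixes l r :: real
  assumes r: "0 < r" "r < l" and N: "N > 0" and small: "(r / l) ^ N \<le> 1 / 2"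
  shows "(\<Sum>\<zeta>::complex | \<zeta> ^ N = 1. 1 / (cmod (of_real l + of_real r * \<zeta>))\<^sup>2) \<le> 3 * real N / (l\<^sup>2 - r\<^sup>2)"
proof -
  let ?Z = "{\<zeta>::complex. \<zeta> ^ N = 1}"
  \<comment> \<open>Chosen so that \<open>l + r * \<zeta> = l * (1 - c * \<zeta>)\<close>. Since
    \<open>\<zeta> ^ N = 1\<close>, the geometric sum of length \<open>N\<close> inverts this factor
    exactly, up to the scalar \<open>1 - c ^ N\<close>.\<close>
  define c where "c = - r / l"
  have c1: "norm (c ^ N) \<le> 1 / 2" using small r by (simp add: c_def power_divide norm_divide norm_power)
  then have c1': "1 - c ^ N \<ge> 1 / 2" using abs_le_D1[of "c ^ N" "1 / 2"] by simp
  have nz: "of_real l + of_real r * \<zeta> \<noteq> 0" if "\<zeta> \<in> ?Z" for \<zeta>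
  proof
    assume "of_real l + of_real r * \<zeta> = 0"
    then have "norm (of_real r * \<zeta>) = norm (of_real l :: complex)"
      by (metis add_eq_0_iff norm_minus_cancel)
    moreover have "norm \<zeta> = 1" using that N by (auto intro: cmod_root_of_unity)
    ultimately show False using r by (simp add: norm_mult)
  qed
  have geo: "of_real l / (of_real l + of_real r * \<zeta>) = (\<Sum>i<N. of_real c ^ i * \<zeta> ^ i) / of_real (1 - c ^ N)"
    if "\<zeta> \<in> ?Z" for \<zeta>
  proof -
    have "(1 - of_real c * \<zeta>) * (\<Sum>i<N. (of_real c * \<zeta>) ^ i) = 1 - (of_real c * \<zeta>) ^ N"
      by (simp add: one_diff_power_eq)
    then have "(1 - of_real c * \<zeta>) * (\<Sum>i<N. of_real c ^ i * \<zeta> ^ i) = of_real (1 - c ^ N)"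
      using that by (simp add: power_mult_distrib)
    moreover have "1 - of_real c * \<zeta> = (of_real l + of_real r * \<zeta>) / of_real l"
      using r by (simp add: c_def field_simps)
    moreover have "of_real (1 - c ^ N) \<noteq> (0::complex)" using c1' by (metis of_real_eq_0_iff not_le zero_less_divide_1_iff zero_less_numeral)
    moreover have "l / d = g / p" if "x * g = p" "x = d / l" "p \<noteq> 0" "d \<noteq> 0" "l \<noteq> 0" for d g l p x :: complex
      using that(3-5) unfolding that(1)[symmetric] that(2) by (simp add: divide_simps)
    moreover have "complex_of_real l \<noteq> 0" using r by simp
    ultimately show ?thesis using nz[OF that] by blast
  qed
  have "(\<Sum>\<zeta>\<in>?Z. of_real l / (of_real l + of_real r * \<zeta>))
      = (\<Sum>i<N. of_real c ^ i * (\<Sum>\<zeta>\<in>?Z. \<zeta> ^ i)) / of_real (1 - c ^ N)"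
    by (subst sum_distrib_left, subst sum.swap) (simp add: geo sum_divide_distrib)
  also have "(\<Sum>i<N. of_real c ^ i * (\<Sum>\<zeta>\<in>?Z. \<zeta> ^ i)) = (\<Sum>i<N. if i = 0 then of_nat N else 0)"
    by (intro sum.cong) (auto simp: sum_roots_of_unity_power[OF N] dest: dvd_imp_le)
  also have "\<dots> = of_nat N" using N by simp
  finally have avg: "(\<Sum>\<zeta>\<in>?Z. of_real l / (of_real l + of_real r * \<zeta>)) = of_real (real N / (1 - c ^ N))"
    by simp
  \<comment> \<open>Poisson kernel identity: with \<open>z = l + r * \<zeta>\<close>, the number
    \<open>2 * Re (l / z) - 1\<close> equals the quotient of \<open>l^2 - r^2\<close> by the squared
    modulus of \<open>z\<close>. So the mean of the inverse squares follows from the mean of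
    \<open>l / z\<close>.\<close>
  have summand: "1 / (cmod (of_real l + of_real r * \<zeta>))\<^sup>2
      = (2 * Re (of_real l / (of_real l + of_real r * \<zeta>)) - 1) / (l\<^sup>2 - r\<^sup>2)" if "\<zeta> \<in> ?Z" for \<zeta>
  proof -
    define n where "n = (cmod (of_real l + of_real r * \<zeta>))\<^sup>2"
    have n0: "n \<noteq> 0" using nz[OF that] by (simp add: n_def)
    have "norm \<zeta> = 1" using that N by (auto intro: cmod_root_of_unity)
    then have z1: "(Re \<zeta>)\<^sup>2 + (Im \<zeta>)\<^sup>2 = 1" using cmod_power2[of \<zeta>] by simp
    have n: "n = (l + r * Re \<zeta>)\<^sup>2 + (r * Im \<zeta>)\<^sup>2" by (simp add: n_def cmod_power2)
    then have n': "n = l\<^sup>2 + 2 * l * r * Re \<zeta> + r\<^sup>2"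
    proof -
      have "n = l\<^sup>2 + 2 * l * r * Re \<zeta> + r\<^sup>2 * ((Re \<zeta>)\<^sup>2 + (Im \<zeta>)\<^sup>2)"
        unfolding n by (simp add: algebra_simps power2_eq_square)
      then show ?thesis by (simp add: z1)
    qed
    have "Re (of_real l / (of_real l + of_real r * \<zeta>)) = l * (l + r * Re \<zeta>) / n"
      by (simp add: Re_divide n power2_eq_square)
    then have "2 * Re (of_real l / (of_real l + of_real r * \<zeta>)) - 1 = (l\<^sup>2 - r\<^sup>2) / n"
      using n0 n' by (simp add: field_simps power2_eq_square)
    moreover have "l\<^sup>2 - r\<^sup>2 \<noteq> 0" using r by (smt (verit) power_strict_mono zero_less_numeral)
    ultimately show ?thesis by (simp add: n_def)
  qed
  have "(\<Sum>\<zeta>\<in>?Z. 1 / (cmod (of_real l + of_real r * \<zeta>))\<^sup>2)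
      = (2 * Re (\<Sum>\<zeta>\<in>?Z. of_real l / (of_real l + of_real r * \<zeta>)) - real N) / (l\<^sup>2 - r\<^sup>2)"
    using card_roots_unity_eq[OF N]
    by (simp add: summand sum_divide_distrib[symmetric] sum_subtractf sum_distrib_left[symmetric])
  also have "\<dots> = (2 * (real N / (1 - c ^ N)) - real N) / (l\<^sup>2 - r\<^sup>2)" unfolding avg by simp
  also have "\<dots> \<le> 3 * real N / (l\<^sup>2 - r\<^sup>2)"
  proof (rule divide_right_mono)
    have "real N / (1 - c ^ N) \<le> real N / (1 / 2)" using c1' by (intro divide_left_mono) auto
    then show "2 * (real N / (1 - c ^ N)) - real N \<le> 3 * real N" by simp
    show "0 \<le> l\<^sup>2 - r\<^sup>2" using r by (simp add: power_mono)
  qed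
  finally show ?thesis .
qed

text \<open>The geometric sum of the propagated errors is bounded by its length times
  \<open>q ^ n\<close>; this avoids dividing by \<open>q - 1\<close> and so covers
  \<open>q = 1\<close>.\<close>

lemma discrete_gronwall:
  fixes d :: "nat \<Rightarrow> real"
  assumes "d 0 \<le> 0" "q \<ge> 1" "\<kappa> \<ge> 0"
    and step: "\<And>k. k < n \<Longrightarrow> d (Suc k) \<le> q * d k + \<kappa>"
  shows "d n \<le> real n * (q ^ n * \<kappa>)"
proof -
  have "d k \<le> real k * (q ^ k * \<kappa>)" if "k \<le> n" for k
    using that
  proof (induction k)
    case (Suc k)
    then have "d (Suc k) \<le> q * (real k * (q ^ k * \<kappa>)) + \<kappa>"
      using step[of k] assms(2) by (smt (verit) Suc_le_lessD less_imp_le_nat mult_left_mono)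
    moreover have "\<kappa> \<le> q ^ Suc k * \<kappa>"
      using assms(2,3) mult_right_mono[of 1 "q ^ Suc k" \<kappa>] one_le_power[of q "Suc k"] by simp
    ultimately show ?case by (simp add: algebra_simps)
  qed (use assms in simp)
  then show ?thesis by simp
qed

section \<open>The resolvent of a single operator\<close>

lemma complex_structure_vector_space:
  assumes "complex_structure J"
  shows "vector_space (csmult J)"
proof
  have JJ: "J (J x) = - x" for x using assms by (simp add: complex_structure_def)
  fix a b :: complex and x y :: 'a
  show "csmult J a (x + y) = csmult J a x + csmult J a y"
    by (simp add: csmult_def blinfun.add_right algebra_simps)
  show "csmult J (a + b) x = csmult J a x + csmult J b x"
    by (simp add: csmult_def algebra_simps)
  show "csmult J a (csmult J b x) = csmult J (a * b) x"
    by (simp add: csmult_def blinfun.add_right blinfun.scaleR_right JJ algebra_simps)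
  show "csmult J 1 x = x" by (simp add: csmult_def)
qed

text \<open>One frozen operator. Every constant obtained in this context depends on
  \<open>M0\<close> and \<omega> only, which is what makes the estimates uniform over the operators
  \<open>A t\<close>.\<close>

locale resolvent_semigroup =
  fixes J :: "'a::banach \<Rightarrow>\<^sub>L 'a" and D :: "'a set" and A :: "'a \<Rightarrow> 'a"
    and S :: "real \<Rightarrow> ('a \<Rightarrow>\<^sub>L 'a)" and M0 \<omega> :: real
  assumes cplx: "complex_structure J"
    and lin: "lin_op J D A"
    and gen: "generates D A S"
    and M0: "M0 \<ge> 1"
    and res: "\<And>z. Re z \<ge> 0 \<Longrightarrow> \<exists>R. resolvent_op J D A z R \<and> norm R \<le> M0 / (cmod z + 1)"
    and S_exp: "\<And>\<tau>. \<tau> \<ge> 0 \<Longrightarrow> norm (S \<tau>) \<le> exp (\<omega> * \<tau>)"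
    and \<omega>: "\<omega> \<ge> 0"
    and dense: "closure D = UNIV"
begin

abbreviation cs :: "complex \<Rightarrow> 'a \<Rightarrow> 'a" (infixr "\<cdot>" 75) where "z \<cdot> x \<equiv> csmult J z x"

sublocale cs: vector_space "csmult J"
  by (rule complex_structure_vector_space[OF cplx])

lemma norm_cs: "norm (z \<cdot> x) = cmod z * norm x"
  using cplx by (simp add: complex_structure_def)

lemma cs_of_real: "of_real a \<cdot> x = a *\<^sub>R x"
  by (simp add: csmult_def)

lemma D_zero: "0 \<in> D" and D_add: "x \<in> D \<Longrightarrow> y \<in> D \<Longrightarrow> x + y \<in> D"
  and D_cs: "x \<in> D \<Longrightarrow> z \<cdot> x \<in> D"
  and A_add: "x \<in> D \<Longrightarrow> y \<in> D \<Longrightarrow> A (x + y) = A x + A y"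
  and A_cs: "x \<in> D \<Longrightarrow> A (z \<cdot> x) = z \<cdot> A x"
  using lin by (auto simp: lin_op_def)

lemma D_scaleR: "x \<in> D \<Longrightarrow> a *\<^sub>R x \<in> D" and A_scaleR: "x \<in> D \<Longrightarrow> A (a *\<^sub>R x) = a *\<^sub>R A x"
  using D_cs[of x "of_real a"] A_cs[of x "of_real a"] by (auto simp: cs_of_real)

lemma D_diff: "x \<in> D \<Longrightarrow> y \<in> D \<Longrightarrow> x - y \<in> D"
  and A_diff: "x \<in> D \<Longrightarrow> y \<in> D \<Longrightarrow> A (x - y) = A x - A y"
  using D_add[of x "(-1) *\<^sub>R y"] A_add[of x "(-1) *\<^sub>R y"] D_scaleR[of y "-1"] A_scaleR[of y "-1"] by auto

lemma A_zero: "A 0 = 0"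
  using A_scaleR[OF D_zero, of 0] by simp

lemma D_sum: "(\<And>i. i \<in> I \<Longrightarrow> f i \<in> D) \<Longrightarrow> sum f I \<in> D"
  by (induction I rule: infinite_finite_induct) (auto simp: D_zero D_add)

lemma A_sum: "(\<And>i. i \<in> I \<Longrightarrow> f i \<in> D) \<Longrightarrow> A (sum f I) = (\<Sum>i\<in>I. A (f i))"
  by (induction I rule: infinite_finite_induct) (auto simp: A_zero A_add D_sum)

definition R :: "complex \<Rightarrow> 'a \<Rightarrow>\<^sub>L 'a" where
  "R z = (SOME R. resolvent_op J D A z R \<and> norm R \<le> M0 / (cmod z + 1))"

context
  fixes z :: complex
  assumes z: "Re z \<ge> 0"
begin

lemma R_props: "resolvent_op J D A z (R z)" "norm (R z) \<le> M0 / (cmod z + 1)"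
  using someI_ex[OF res[OF z]] by (auto simp: R_def)

lemma R_D: "R z y \<in> D" and A_R: "A (R z y) = z \<cdot> R z y - y"
  and R_inv: "x \<in> D \<Longrightarrow> R z (z \<cdot> x - A x) = x"
  using R_props(1) by (auto simp: resolvent_op_def algebra_simps)

lemma norm_R_le: "norm (R z y) \<le> M0 / (cmod z + 1) * norm y"
  using order_trans[OF norm_blinfun mult_right_mono[OF R_props(2)]] by simp

lemma norm_R_le_M0: "norm (R z y) \<le> M0 * norm y"
proof -
  have "M0 / (cmod z + 1) \<le> M0 / 1" using M0 by (intro divide_left_mono) (auto intro: add_nonneg_pos)
  then show ?thesis using norm_R_le[of y] mult_right_mono[of _ M0 "norm y"] by fastforce
qed

lemma norm_R_le_inverse: "norm (R z y) \<le> M0 / cmod z * norm y" if "z \<noteq> 0"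
proof -
  have "M0 / (cmod z + 1) \<le> M0 / cmod z" using M0 that by (intro divide_left_mono mult_pos_pos) (auto intro: add_nonneg_pos)
  then show ?thesis using norm_R_le[of y] mult_right_mono[of _ "M0 / cmod z" "norm y"] by fastforce
qed

text \<open>From \<open>A R(z) = z R(z) - I\<close>: one resolvent absorbs \<open>A\<close> at a
  cost that is uniform in the right half plane.\<close>

lemma norm_A_R_le: "norm (A (R z y)) \<le> (M0 + 1) * norm y"
proof -
  have "cmod z * norm (R z y) \<le> cmod z * (M0 / (cmod z + 1) * norm y)"
    by (intro mult_left_mono norm_R_le) simp
  also have "\<dots> = cmod z / (cmod z + 1) * (M0 * norm y)" by simp
  also have "\<dots> \<le> 1 * (M0 * norm y)" using M0 by (intro mult_right_mono) (auto simp: divide_le_eq not_less intro: add_nonneg_pos dest: order_trans[OF norm_ge_zero])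
  finally show ?thesis
    using norm_triangle_ineq4[of "z \<cdot> R z y" y] by (simp add: A_R norm_cs algebra_simps)
qed

text \<open>By its type \<open>R z\<close> is only real linear; complex homogeneity comes from the
  complex linearity of \<open>A\<close> and the uniqueness of the solution of the resolvent
  equation.\<close>

lemma R_cs: "R z (a \<cdot> x) = a \<cdot> R z x"
proof -
  have "R z (a \<cdot> x) = R z (z \<cdot> (a \<cdot> R z x) - A (a \<cdot> R z x))"
    by (simp add: A_cs R_D A_R cs.scale_right_diff_distrib mult.commute)
  also have "\<dots> = a \<cdot> R z x" by (intro R_inv D_cs R_D)
  finally show ?thesis .
qed

lemma R_A: "x \<in> D \<Longrightarrow> R z (A x) = A (R z x)"
  using R_inv[of x] by (simp add: blinfun.diff_right R_cs A_R algebra_simps)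

end

abbreviation Rp :: "complex \<Rightarrow> nat \<Rightarrow> 'a \<Rightarrow> 'a" where "Rp z n \<equiv> blinfun_apply (R z) ^^ n"

lemma R_power_A: "x \<in> D \<Longrightarrow> Re z \<ge> 0 \<Longrightarrow> Rp z n x \<in> D \<and> Rp z n (A x) = A (Rp z n x)"
  by (induction n) (auto simp: R_A R_D)

section \<open>Taylor expansion of the cubed resolvent\<close>

lemma resolvent_identity:
  assumes "Re z \<ge> 0" "Re (z + w) \<ge> 0"
  shows "R (z + w) v = R z v + (- w) \<cdot> R z (R (z + w) v)"
proof -
  let ?u = "R (z + w) v"
  have "z \<cdot> ?u - A ?u = v + (- w) \<cdot> ?u"
    using assms by (simp add: A_R cs.scale_left_distrib)
  then have "?u = R z (v + (- w) \<cdot> ?u)" using R_inv[of z ?u] R_D assms by simp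
  then show ?thesis using assms by (simp add: blinfun.diff_right R_cs)
qed

lemma linear_R_power: "linear (Rp z n)"
  by (induction n) (auto simp: linear_iff blinfun.add_right blinfun.scaleR_right)

lemma R_power_add: "Rp z n (x + y) = Rp z n x + Rp z n y"
  using linear_R_power by (simp add: linear_iff)

lemma R_power_cs: "Re z \<ge> 0 \<Longrightarrow> Rp z n (a \<cdot> x) = a \<cdot> Rp z n x"
  by (induction n) (auto simp: R_cs)

text \<open>The expansion of \<open>R(z + w)^3\<close> about \<open>z\<close>, with the coefficients
  of \<open>(1 + x)^-3\<close>. It is a finite identity with an explicit remainder, so no
  convergence has to be discussed; the bracket in the remainder reproduces itself from
  \<open>N\<close> to \<open>N + 1\<close>.\<close>

lemma resolvent_cube_expansion:
  assumes "Re z \<ge> 0" "Re (z + w) \<ge> 0"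
  defines "Q \<equiv> R (z + w)"
  shows "Q (Q (Q y)) = (\<Sum>i<N. (of_nat ((i + 2) choose 2) * (- w) ^ i) \<cdot> Rp z (i + 3) y)
    + (- w) ^ N \<cdot> Rp z N (Q (Q (Q y)) + of_nat N \<cdot> R z (Q (Q y)) + of_nat ((N + 1) choose 2) \<cdot> R z (R z (Q y)))"
proof (induction N)
  case 0
  show ?case by (simp add: numeral_2_eq_2)
next
  case (Suc N)
  have id: "Q v = R z v + (- w) \<cdot> R z (Q v)" for v
    unfolding Q_def by (rule resolvent_identity) fact+
  have lin: "R z (a + b) = R z a + R z b" "R z (c \<cdot> a) = c \<cdot> R z a" for a b c
    using assms by (auto simp: blinfun.add_right R_cs)
  have e1: "Q (Q (Q y)) = R z (Q (Q y)) + (- w) \<cdot> R z (Q (Q (Q y)))" by (rule id)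
  have e2: "R z (Q (Q y)) = R z (R z (Q y)) + (- w) \<cdot> R z (R z (Q (Q y)))"
    by (subst id[of "Q y"]) (simp only: lin)
  have e3: "R z (R z (Q y)) = R z (R z (R z y)) + (- w) \<cdot> R z (R z (R z (Q y)))"
    by (subst id[of y]) (simp only: lin)
  let ?T = "\<lambda>N. Q (Q (Q y)) + of_nat N \<cdot> R z (Q (Q y)) + of_nat ((N + 1) choose 2) \<cdot> R z (R z (Q y))"
  have ch: "(Suc (N + 1) choose 2) = (N + 1 choose 2) + Suc N" by (simp add: numeral_2_eq_2)
  \<comment> \<open>The identities \<open>e1\<close>, \<open>e2\<close>, \<open>e3\<close> turn the
    three terms one after the other: each leaves a piece with a factor \<open>- w\<close> and a
    piece with one more unshifted resolvent, which joins the next term. The coefficients add up by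
    Pascal's rule \<open>ch\<close>.\<close>
  have "?T N = (- w) \<cdot> R z (Q (Q (Q y))) + of_nat (Suc N) \<cdot> R z (Q (Q y)) + of_nat ((N + 1) choose 2) \<cdot> R z (R z (Q y))"
    by (subst e1) (simp add: cs.scale_left_distrib)
  also have "\<dots> = (- w) \<cdot> R z (Q (Q (Q y))) + of_nat (Suc N) \<cdot> ((- w) \<cdot> R z (R z (Q (Q y)))) + of_nat (Suc (N + 1) choose 2) \<cdot> R z (R z (Q y))"
    by (subst e2) (simp only: ch of_nat_add cs.scale_left_distrib cs.scale_right_distrib, simp only: add_ac)
  also have "\<dots> = of_nat (Suc (N + 1) choose 2) \<cdot> R z (R z (R z y)) + (- w) \<cdot> R z (?T (Suc N))"
    by (subst e3) (simp add: lin cs.scale_right_distrib algebra_simps)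
  finally have T: "?T N = \<dots>" .
  have step: "(- w) ^ N \<cdot> Rp z N (c \<cdot> R z (R z (R z y)) + (- w) \<cdot> R z v)
      = (c * (- w) ^ N) \<cdot> Rp z (N + 3) y + (- w) ^ Suc N \<cdot> Rp z (Suc N) v" for c v
  proof -
    have "Rp z (N + 3) y = Rp z N (R z (R z (R z y)))"
      by (simp add: funpow_add funpow_swap1 numeral_3_eq_3)
    moreover have "Rp z (Suc N) v = Rp z N (R z v)" by (simp add: funpow_swap1)
    ultimately show ?thesis using assms
      by (simp only: R_power_add R_power_cs cs.scale_right_distrib cs.scale_scale power_Suc2 mult.commute[of c])
  qed
  have F: "(- w) ^ N \<cdot> Rp z N (?T N)
    = (of_nat ((N + 2) choose 2) * (- w) ^ N) \<cdot> Rp z (N + 3) y + (- w) ^ Suc N \<cdot> Rp z (Suc N) (?T (Suc N))"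
    using step[of "of_nat (Suc (N + 1) choose 2)" "?T (Suc N)"] unfolding T by simp
  have "a = s + t \<Longrightarrow> t = u + v \<Longrightarrow> a = s + u + v" for a s t u v :: 'a
    by simp
  from this[OF Suc.IH F] show ?case unfolding sum.lessThan_Suc .
qed

text \<open>The bound on \<open>S h\<close> differentiated at \<open>h = 0\<close>, as in the easy
  half of the Lumer-Phillips theorem. It bounds the resolvent on the real axis by
  \<open>1 / (l - \<omega>)\<close> with constant one, so that powers of the resolvent do not
  accumulate powers of \<open>M0\<close>.\<close>

lemma dissipative:
  assumes "x \<in> D"
  shows "(l - \<omega>) * norm x \<le> norm (l *\<^sub>R x - A x)"
proof (rule tendsto_le[of "at_right (0::real)"])
  have "((\<lambda>h. (1 / h) *\<^sub>R (S h x - x)) \<longlongrightarrow> A x) (at_right 0)"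
    using gen assms by (simp add: generates_def)
  then show "((\<lambda>h. norm (l *\<^sub>R x - (1 / h) *\<^sub>R (S h x - x))) \<longlongrightarrow> norm (l *\<^sub>R x - A x)) (at_right 0)"
    by (intro tendsto_intros)
  have "((\<lambda>h. exp (\<omega> * h)) has_real_derivative \<omega>) (at 0)"
    by (auto intro!: derivative_eq_intros)
  then have "((\<lambda>h. (exp (\<omega> * h) - 1) / h) \<longlongrightarrow> \<omega>) (at_right 0)"
    by (auto simp: DERIV_def intro: tendsto_mono[OF at_le])
  then show "((\<lambda>h. (l - (exp (\<omega> * h) - 1) / h) * norm x) \<longlongrightarrow> (l - \<omega>) * norm x) (at_right 0)"
    by (intro tendsto_intros)
  have "(l - (exp (\<omega> * h) - 1) / h) * norm x \<le> norm (l *\<^sub>R x - (1 / h) *\<^sub>R (S h x - x))" if "h > 0" for h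
  proof -
    have "norm (S h x) \<le> exp (\<omega> * h) * norm x"
      using order_trans[OF norm_blinfun mult_right_mono[OF S_exp]] that by simp
    moreover have "norm ((1 + l * h) *\<^sub>R x) \<ge> (1 + l * h) * norm x" by (simp add: mult_right_mono)
    ultimately have "(1 + l * h - exp (\<omega> * h)) * norm x \<le> norm ((1 + l * h) *\<^sub>R x - S h x)"
      using norm_triangle_ineq2[of "(1 + l * h) *\<^sub>R x" "S h x"] by (simp add: left_diff_distrib)
    also have "(1 + l * h) *\<^sub>R x - S h x = h *\<^sub>R (l *\<^sub>R x - (1 / h) *\<^sub>R (S h x - x))"
      using that by (simp add: algebra_simps)
    finally have "(1 + l * h - exp (\<omega> * h)) * norm x \<le> h * norm (l *\<^sub>R x - (1 / h) *\<^sub>R (S h x - x))"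
      using that by (simp only: norm_scaleR abs_of_pos)
    then have "(1 + l * h - exp (\<omega> * h)) / h * norm x \<le> norm (l *\<^sub>R x - (1 / h) *\<^sub>R (S h x - x))"
      using that by (simp add: pos_divide_le_eq mult.commute)
    moreover have "(1 + l * h - exp (\<omega> * h)) / h = l - (exp (\<omega> * h) - 1) / h"
      using that by (simp add: field_simps)
    ultimately show ?thesis by simp
  qed
  then show "\<forall>\<^sub>F h in at_right 0. (l - (exp (\<omega> * h) - 1) / h) * norm x \<le> norm (l *\<^sub>R x - (1 / h) *\<^sub>R (S h x - x))"
    using eventually_at_right_less[of "0::real"] by (rule eventually_mono[rotated])
qed simp

lemma norm_R_real_le:
  assumes "\<omega> < l"
  shows "norm (R (of_real l) y) \<le> norm y / (l - \<omega>)"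
proof -
  have "Re (of_real l) \<ge> 0" using assms \<omega> by simp
  then show ?thesis
    using dissipative[OF R_D, of "of_real l" l y] A_R[of "of_real l" y] assms
    by (simp add: cs_of_real pos_le_divide_eq mult.commute)
qed

lemma norm_R_power_le:
  assumes "\<omega> < l"
  shows "norm (Rp (of_real l) n y) \<le> norm y / (l - \<omega>) ^ n"
proof (induction n)
  case (Suc n)
  have "norm (Rp (of_real l) (Suc n) y) \<le> norm (Rp (of_real l) n y) / (l - \<omega>)"
    using norm_R_real_le[OF assms] by simp
  also have "\<dots> \<le> norm y / (l - \<omega>) ^ n / (l - \<omega>)"
    using Suc assms by (intro divide_right_mono) auto
  finally show ?case by (simp add: mult.commute)
qed simp

text \<open>Cauchy's estimate for the \<open>m\<close>-th Taylor coefficient of \<open>A R(l + w)^3\<close> on the circle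
\<open>|w| = r\<close>, with the mean over the circle replaced by the mean over \<open>N\<close>-th roots of unity, \<open>N \<rightarrow> \<infinity>\<close>.
The third power makes \<open>\<parallel>A R(z)^3\<parallel> = O(|z|\<^sup>-\<^sup>2)\<close> integrable along the circle.\<close>

lemma norm_A_R_power_le:
  assumes r: "0 < r" "r < l - \<omega>"
  shows "real ((m + 2) choose 2) * r ^ m * norm (A (Rp (of_real l) (m + 3) y))
    \<le> 3 * (M0 + 1) * M0\<^sup>2 / (l\<^sup>2 - r\<^sup>2) * norm y"
proof -
  \<comment> \<open>The remainder carries \<open>r ^ N\<close> against about \<open>N\<close>
    resolvents of size \<open>1 / (l - \<omega>)\<close>, hence decays like \<open>q ^ N\<close> up
    to a polynomial factor.\<close>
  define q where "q = r / (l - \<omega>)"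
  have q: "0 \<le> q" "q < 1" using r by (auto simp: q_def)
  have rl: "r < l" using r \<omega> by simp
  have l0: "0 < l" using rl r by simp
  let ?l = "complex_of_real l"
  let ?X = "real ((m + 2) choose 2) * r ^ m * norm (A (Rp ?l (m + 3) y))"
  let ?Y = "3 * (M0 + 1) * M0\<^sup>2 / (l\<^sup>2 - r\<^sup>2) * norm y"
  define c where "c = 2 * (M0 + 1) * M0 ^ 3 * (l - \<omega>) * norm y"
  have main: "?X \<le> ?Y + c * ((real N + 1)\<^sup>2 * q ^ N)" if N: "m < N" "(r / l) ^ N \<le> 1 / 2" for N
  proof -
    let ?Z = "{\<zeta>::complex. \<zeta> ^ N = 1}"
    have N0: "N > 0" using N by simp
    define Q where "Q \<zeta> = R (?l + of_real r * \<zeta>)" for \<zeta>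
    define T where "T \<zeta> = Q \<zeta> (Q \<zeta> (Q \<zeta> y)) + of_nat N \<cdot> R ?l (Q \<zeta> (Q \<zeta> y)) + of_nat ((N + 1) choose 2) \<cdot> R ?l (R ?l (Q \<zeta> y))" for \<zeta>
    have Zn: "cmod \<zeta> = 1" if "\<zeta> \<in> ?Z" for \<zeta> using that N0 cmod_root_of_unity by auto
    have Zre: "Re (?l + of_real r * \<zeta>) > 0" if "\<zeta> \<in> ?Z" for \<zeta>
    proof -
      have "\<bar>Re \<zeta>\<bar> \<le> 1" using abs_Re_le_cmod[of \<zeta>] Zn[OF that] by simp
      then have "r * - 1 \<le> r * Re \<zeta>" using r by (intro mult_left_mono) auto
      then show ?thesis using rl by simp
    qed
    have lre: "Re ?l \<ge> 0" using l0 by simp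
    let ?k = "\<lambda>i. of_nat ((i + 2) choose 2) * (- of_real r) ^ i :: complex"
    \<comment> \<open>The weight \<open>\<zeta> ^ (N - m)\<close> stands for \<open>\<zeta>\<close>
      to the power \<open>- m\<close> while keeping exponents natural. Among \<open>i < N\<close>
      only \<open>i = m\<close> makes \<open>N - m + i\<close> divisible by \<open>N\<close>, so
      summation isolates the \<open>m\<close>-th Taylor coefficient.\<close>
    have "(\<Sum>\<zeta>\<in>?Z. \<zeta> ^ (N - m) \<cdot> Q \<zeta> (Q \<zeta> (Q \<zeta> y)))
      = (\<Sum>\<zeta>\<in>?Z. (\<Sum>i<N. (?k i * \<zeta> ^ (N - m + i)) \<cdot> Rp ?l (i + 3) y) + (\<zeta> ^ (N - m) * (- of_real r) ^ N) \<cdot> Rp ?l N (T \<zeta>))"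
    proof (rule sum.cong[OF refl])
      fix \<zeta> assume \<zeta>: "\<zeta> \<in> ?Z"
      have pw: "(- (of_real r * \<zeta>)) ^ i = (- of_real r) ^ i * \<zeta> ^ i" for i
        by (metis mult_minus_left power_mult_distrib)
      have "Q \<zeta> (Q \<zeta> (Q \<zeta> y)) = (\<Sum>i<N. (?k i * \<zeta> ^ i) \<cdot> Rp ?l (i + 3) y) + ((- of_real r) ^ N) \<cdot> Rp ?l N (T \<zeta>)"
        using resolvent_cube_expansion[of ?l "of_real r * \<zeta>" y N] lre Zre[OF \<zeta>] \<zeta>
        by (simp add: Q_def T_def pw mult.assoc)
      then show "\<zeta> ^ (N - m) \<cdot> Q \<zeta> (Q \<zeta> (Q \<zeta> y)) = (\<Sum>i<N. (?k i * \<zeta> ^ (N - m + i)) \<cdot> Rp ?l (i + 3) y) + (\<zeta> ^ (N - m) * (- of_real r) ^ N) \<cdot> Rp ?l N (T \<zeta>)"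
        by (simp add: cs.scale_right_distrib cs.scale_sum_right power_add mult_ac)
    qed
    also have "\<dots> = (\<Sum>i<N. (?k i * (\<Sum>\<zeta>\<in>?Z. \<zeta> ^ (N - m + i))) \<cdot> Rp ?l (i + 3) y)
        + (\<Sum>\<zeta>\<in>?Z. (\<zeta> ^ (N - m) * (- of_real r) ^ N) \<cdot> Rp ?l N (T \<zeta>))"
      by (simp add: sum.distrib sum.swap[of _ "?Z"] sum_distrib_left cs.scale_sum_left)
    also have "(\<Sum>i<N. (?k i * (\<Sum>\<zeta>\<in>?Z. \<zeta> ^ (N - m + i))) \<cdot> Rp ?l (i + 3) y)
        = (\<Sum>i<N. if i = m then (?k m * of_nat N) \<cdot> Rp ?l (m + 3) y else 0)"
    proof (rule sum.cong[OF refl])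
      fix i assume i: "i \<in> {..<N}"
      have "N dvd (N - m + i) \<longleftrightarrow> i = m"
      proof
        assume "N dvd N - m + i"
        then obtain j where j: "N - m + i = N * j" by (elim dvdE)
        have "N - m + i < N * 2" "0 < N - m + i" using i N by auto
        then have "N * j < N * 2" "0 < N * j" unfolding j by auto
        then have "j < 2" "0 < j" using N0 by (simp_all only: mult_less_cancel1 nat_0_less_mult_iff)
        then have "j = 1" by auto
        then show "i = m" using j N by simp
      qed (use N in simp)
      then show "(?k i * (\<Sum>\<zeta>\<in>?Z. \<zeta> ^ (N - m + i))) \<cdot> Rp ?l (i + 3) y = (if i = m then (?k m * of_nat N) \<cdot> Rp ?l (m + 3) y else 0)"
        by (simp add: sum_roots_of_unity_power[OF N0] del: binomial_Suc_Suc)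
    qed
    also have "\<dots> = (?k m * of_nat N) \<cdot> Rp ?l (m + 3) y" using N by simp
    finally have sumid: "(?k m * of_nat N) \<cdot> Rp ?l (m + 3) y
       = (\<Sum>\<zeta>\<in>?Z. \<zeta> ^ (N - m) \<cdot> Q \<zeta> (Q \<zeta> (Q \<zeta> y))) - (\<Sum>\<zeta>\<in>?Z. (\<zeta> ^ (N - m) * (- of_real r) ^ N) \<cdot> Rp ?l N (T \<zeta>))"
      by simp
    have RpD: "Rp ?l n v \<in> D" if "n > 0" for n v
      using that lre by (cases n) (auto intro: R_D)
    have QD: "Q \<zeta> v \<in> D" if "\<zeta> \<in> ?Z" for \<zeta> v
      using Zre[OF that] by (auto simp: Q_def intro: R_D)
    have "(?k m * of_nat N) \<cdot> A (Rp ?l (m + 3) y)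
       = (\<Sum>\<zeta>\<in>?Z. \<zeta> ^ (N - m) \<cdot> A (Q \<zeta> (Q \<zeta> (Q \<zeta> y)))) - (\<Sum>\<zeta>\<in>?Z. (\<zeta> ^ (N - m) * (- of_real r) ^ N) \<cdot> A (Rp ?l N (T \<zeta>)))"
    proof -
      have "(?k m * of_nat N) \<cdot> A (Rp ?l (m + 3) y) = A ((?k m * of_nat N) \<cdot> Rp ?l (m + 3) y)"
        by (rule A_cs[symmetric], rule RpD) simp
      also have "\<dots> = A (\<Sum>\<zeta>\<in>?Z. \<zeta> ^ (N - m) \<cdot> Q \<zeta> (Q \<zeta> (Q \<zeta> y))) - A (\<Sum>\<zeta>\<in>?Z. (\<zeta> ^ (N - m) * (- of_real r) ^ N) \<cdot> Rp ?l N (T \<zeta>))"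
        unfolding sumid using QD RpD N0 by (intro A_diff D_sum D_cs) auto
      also have "A (\<Sum>\<zeta>\<in>?Z. \<zeta> ^ (N - m) \<cdot> Q \<zeta> (Q \<zeta> (Q \<zeta> y))) = (\<Sum>\<zeta>\<in>?Z. \<zeta> ^ (N - m) \<cdot> A (Q \<zeta> (Q \<zeta> (Q \<zeta> y))))"
        using QD by (subst A_sum) (auto intro!: D_cs sum.cong A_cs)
      also have "A (\<Sum>\<zeta>\<in>?Z. (\<zeta> ^ (N - m) * (- of_real r) ^ N) \<cdot> Rp ?l N (T \<zeta>)) = (\<Sum>\<zeta>\<in>?Z. (\<zeta> ^ (N - m) * (- of_real r) ^ N) \<cdot> A (Rp ?l N (T \<zeta>)))"
        using RpD N0 by (subst A_sum) (auto intro!: D_cs sum.cong A_cs)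
      finally show ?thesis .
    qed
    then have "norm ((?k m * of_nat N) \<cdot> A (Rp ?l (m + 3) y))
       \<le> norm (\<Sum>\<zeta>\<in>?Z. \<zeta> ^ (N - m) \<cdot> A (Q \<zeta> (Q \<zeta> (Q \<zeta> y)))) + norm (\<Sum>\<zeta>\<in>?Z. (\<zeta> ^ (N - m) * (- of_real r) ^ N) \<cdot> A (Rp ?l N (T \<zeta>)))"
      by (simp only: norm_triangle_ineq4)
    \<comment> \<open>One of the three resolvents absorbs \<open>A\<close>; the other two contribute
      \<open>M0 / cmod z\<close> each, which leaves the sum of inverse squares computed
      before.\<close>
    also have "norm (\<Sum>\<zeta>\<in>?Z. \<zeta> ^ (N - m) \<cdot> A (Q \<zeta> (Q \<zeta> (Q \<zeta> y))))
        \<le> (\<Sum>\<zeta>\<in>?Z. (M0 + 1) * M0\<^sup>2 * norm y * (1 / (cmod (?l + of_real r * \<zeta>))\<^sup>2))"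
    proof (rule sum_norm_le)
      fix \<zeta> assume \<zeta>: "\<zeta> \<in> ?Z"
      let ?z = "?l + of_real r * \<zeta>"
      have z: "Re ?z \<ge> 0" "?z \<noteq> 0" using Zre[OF \<zeta>] by (auto simp only: less_imp_le zero_complex.sel)
      have "norm (\<zeta> ^ (N - m) \<cdot> A (Q \<zeta> (Q \<zeta> (Q \<zeta> y)))) = norm (A (Q \<zeta> (Q \<zeta> (Q \<zeta> y))))"
        using Zn[OF \<zeta>] by (simp add: norm_cs norm_power)
      also have "\<dots> \<le> (M0 + 1) * norm (Q \<zeta> (Q \<zeta> y))"
        unfolding Q_def using z(1) by (rule norm_A_R_le)
      also have "\<dots> \<le> (M0 + 1) * (M0 / cmod ?z * (M0 / cmod ?z * norm y))"
        using M0 unfolding Q_def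
        by (intro mult_left_mono order_trans[OF norm_R_le_inverse[OF z]] norm_R_le_inverse[OF z]) auto
      finally show "norm (\<zeta> ^ (N - m) \<cdot> A (Q \<zeta> (Q \<zeta> (Q \<zeta> y)))) \<le> (M0 + 1) * M0\<^sup>2 * norm y * (1 / (cmod ?z)\<^sup>2)"
        by (simp add: power2_eq_square mult_ac)
    qed
    also have "\<dots> = (M0 + 1) * M0\<^sup>2 * norm y * (\<Sum>\<zeta>\<in>?Z. 1 / (cmod (?l + of_real r * \<zeta>))\<^sup>2)"
      by (rule sum_distrib_left[symmetric])
    also have "\<dots> \<le> (M0 + 1) * M0\<^sup>2 * norm y * (3 * real N / (l\<^sup>2 - r\<^sup>2))"
      using M0 by (intro mult_left_mono sum_inverse_norm_square r rl N0 N) auto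
    also have "\<dots> = real N * ?Y" by simp
    also have "norm (\<Sum>\<zeta>\<in>?Z. (\<zeta> ^ (N - m) * (- of_real r) ^ N) \<cdot> A (Rp ?l N (T \<zeta>)))
        \<le> (\<Sum>\<zeta>\<in>?Z. c * ((real N + 1)\<^sup>2 * q ^ N))"
    proof (rule sum_norm_le)
      fix \<zeta> assume \<zeta>: "\<zeta> \<in> ?Z"
      have z: "Re (?l + of_real r * \<zeta>) \<ge> 0" using Zre[OF \<zeta>] by auto
      have Qle: "norm (Q \<zeta> v) \<le> M0 * norm v" for v unfolding Q_def using z by (rule norm_R_le_M0)
      have Rle: "norm (R ?l v) \<le> M0 * norm v" for v using lre by (rule norm_R_le_M0)
      have M00: "0 \<le> M0" using M0 by simp
      have t1: "norm (Q \<zeta> (Q \<zeta> (Q \<zeta> y))) \<le> M0 * (M0 * (M0 * norm y))"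
        by (intro order_trans[OF Qle] mult_left_mono Qle M00)
      have t2: "norm (R ?l (Q \<zeta> (Q \<zeta> y))) \<le> M0 * (M0 * (M0 * norm y))"
        by (intro order_trans[OF Rle] order_trans[OF Qle] mult_left_mono Qle M00)
      have t3: "norm (R ?l (R ?l (Q \<zeta> y))) \<le> M0 * (M0 * (M0 * norm y))"
        by (intro order_trans[OF Rle] mult_left_mono Qle M00)
      have "norm (T \<zeta>) \<le> norm (Q \<zeta> (Q \<zeta> (Q \<zeta> y))) + real N * norm (R ?l (Q \<zeta> (Q \<zeta> y))) + real ((N + 1) choose 2) * norm (R ?l (R ?l (Q \<zeta> y)))"
        unfolding T_def by (intro norm_triangle_le add_mono) (auto simp: norm_cs norm_mult)
      also have "\<dots> \<le> M0 * (M0 * (M0 * norm y)) + real N * (M0 * (M0 * (M0 * norm y))) + real ((N + 1) choose 2) * (M0 * (M0 * (M0 * norm y)))"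
        by (intro add_mono mult_left_mono t1 t2 t3) auto
      also have "\<dots> = (1 + real N + real ((N + 1) choose 2)) * (M0 ^ 3 * norm y)"
        by (simp add: power3_eq_cube algebra_simps)
      also have "\<dots> \<le> (2 * (real N + 1)\<^sup>2) * (M0 ^ 3 * norm y)"
      proof (rule mult_right_mono)
        have "real ((N + 1) choose 2) \<le> (real N + 1)\<^sup>2"
        proof -
          have "(N + 1) choose 2 \<le> (N + 1)\<^sup>2"
            unfolding choose_two power2_eq_square
            by (rule order_trans[OF div_le_dividend]) (intro mult_le_mono, simp_all)
          then have "real ((N + 1) choose 2) \<le> real ((N + 1)\<^sup>2)" by (rule of_nat_mono)
          then show ?thesis by (simp add: add.commute)
        qed
        moreover have "real N + 1 \<le> (real N + 1)\<^sup>2" by (simp add: power2_eq_square)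
        ultimately show "1 + real N + real ((N + 1) choose 2) \<le> 2 * (real N + 1)\<^sup>2" by simp
      qed (use M0 in simp)
      finally have T: "norm (T \<zeta>) \<le> 2 * (real N + 1)\<^sup>2 * (M0 ^ 3 * norm y)" .
      \<comment> \<open>One of the \<open>N\<close> resolvents is spent on \<open>A\<close>, leaving
        \<open>N - 1\<close> decaying factors; the missing one accounts for the factor
        \<open>l - \<omega>\<close> in \<open>c\<close>.\<close>
      obtain N' where N': "N = Suc N'" using N0 by (cases N) auto
      have "norm ((\<zeta> ^ (N - m) * (- of_real r) ^ N) \<cdot> A (Rp ?l N (T \<zeta>))) = r ^ N * norm (A (Rp ?l N (T \<zeta>)))"
        using Zn[OF \<zeta>] r by (simp add: norm_cs norm_mult norm_power)
      also have "\<dots> \<le> r ^ N * ((M0 + 1) * (norm (T \<zeta>) / (l - \<omega>) ^ N'))"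
      proof (rule mult_left_mono)
        have "norm (A (Rp ?l N (T \<zeta>))) \<le> (M0 + 1) * norm (Rp ?l N' (T \<zeta>))"
          using norm_A_R_le[OF lre] by (simp add: N')
        also have "\<dots> \<le> (M0 + 1) * (norm (T \<zeta>) / (l - \<omega>) ^ N')"
          using M0 r by (intro mult_left_mono norm_R_power_le) auto
        finally show "norm (A (Rp ?l N (T \<zeta>))) \<le> \<dots>" .
      qed (use r in simp)
      also have "\<dots> \<le> r ^ N * ((M0 + 1) * (2 * (real N + 1)\<^sup>2 * (M0 ^ 3 * norm y) / (l - \<omega>) ^ N'))"
        using M0 r by (intro mult_left_mono divide_right_mono T) auto
      also have "\<dots> = c * ((real N + 1)\<^sup>2 * q ^ N)"
        using r by (simp add: c_def q_def N' power_divide)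
      finally show "norm ((\<zeta> ^ (N - m) * (- of_real r) ^ N) \<cdot> A (Rp ?l N (T \<zeta>))) \<le> c * ((real N + 1)\<^sup>2 * q ^ N)" .
    qed
    also have "\<dots> = real N * (c * ((real N + 1)\<^sup>2 * q ^ N))"
      using card_roots_unity_eq[OF N0] by simp
    finally have "norm ((?k m * of_nat N) \<cdot> A (Rp ?l (m + 3) y)) \<le> real N * (?Y + c * ((real N + 1)\<^sup>2 * q ^ N))"
      by (simp add: distrib_left)
    also have "norm ((?k m * of_nat N) \<cdot> A (Rp ?l (m + 3) y)) = real N * ?X"
      using r by (simp add: norm_cs norm_mult norm_power del: binomial_Suc_Suc)
    finally show ?thesis using N0 by simp
  qed
  \<comment> \<open>The square root splits the decay evenly, so the quadratic growth reduces to the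
    limit of \<open>N\<close> times a geometric sequence, squared.\<close>
  have "(\<lambda>N. ((real N * sqrt q ^ N) + sqrt q ^ N)\<^sup>2) \<longlonglongrightarrow> (0 + 0)\<^sup>2"
    using q by (intro tendsto_intros powser_times_n_limit_0 LIMSEQ_power_zero) auto
  moreover have "(real N + 1)\<^sup>2 * q ^ N = ((real N * sqrt q ^ N) + sqrt q ^ N)\<^sup>2" for N
  proof -
    have "q ^ N = (sqrt q ^ N)\<^sup>2" using q by (metis power_commutes power_mult real_sqrt_pow2 mult.commute)
    then show ?thesis by (simp add: power_mult_distrib[symmetric] algebra_simps)
  qed
  ultimately have "(\<lambda>N. (real N + 1)\<^sup>2 * q ^ N) \<longlonglongrightarrow> 0" by simp
  then have "(\<lambda>N. ?Y + c * ((real N + 1)\<^sup>2 * q ^ N)) \<longlonglongrightarrow> ?Y + c * 0"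
    by (intro tendsto_intros)
  moreover have "\<forall>\<^sub>F N in sequentially. ?X \<le> ?Y + c * ((real N + 1)\<^sup>2 * q ^ N)"
  proof -
    have "(\<lambda>N. (r / l) ^ N) \<longlonglongrightarrow> 0" using r rl by (intro LIMSEQ_power_zero) auto
    then have "\<forall>\<^sub>F N in sequentially. (r / l) ^ N < 1 / 2" by (rule order_tendstoD) simp
    then show ?thesis using eventually_gt_at_top[of m] by eventually_elim (intro main, auto)
  qed
  ultimately show ?thesis using tendsto_lowerbound[of _ _ sequentially ?X] by simp
qed

end

section \<open>Exponential formula and analytic smoothing\<close>

context resolvent_semigroup
begin

section \<open>Orbits of the semigroup in the domain\<close>

lemma S_zero: "S 0 x = x"
  and S_add: "a \<ge> 0 \<Longrightarrow> b \<ge> 0 \<Longrightarrow> S (a + b) x = S a (S b x)"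
  and continuous_on_S: "continuous_on {0..} (\<lambda>\<tau>. S \<tau> x)"
  using gen by (auto simp: generates_def C0_semigroup_def)

lemma norm_S_le: "\<tau> \<ge> 0 \<Longrightarrow> norm (S \<tau> x) \<le> exp (\<omega> * \<tau>) * norm x"
  using order_trans[OF norm_blinfun mult_right_mono[OF S_exp]] by simp

lemma S_right_derivative_zero:
  "x \<in> D \<Longrightarrow> ((\<lambda>h. (1 / h) *\<^sub>R (S h x - x)) \<longlongrightarrow> A x) (at_right 0)"
  using gen by (simp add: generates_def)

text \<open>\<open>S \<tau>\<close> commutes with the difference quotients at zero. As
  \<open>generates\<close> takes \<open>D\<close> to be the set of all points where these converge,
  both the invariance of \<open>D\<close> and \<open>A S = S A\<close> follow.\<close>

lemma S_shift:
  assumes "x \<in> D" "\<tau> \<ge> 0"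
  shows "((\<lambda>h. (1 / h) *\<^sub>R (S h (S \<tau> x) - S \<tau> x)) \<longlongrightarrow> S \<tau> (A x)) (at_right 0)"
proof (rule Lim_transform_eventually)
  show "((\<lambda>h. S \<tau> ((1 / h) *\<^sub>R (S h x - x))) \<longlongrightarrow> S \<tau> (A x)) (at_right 0)"
    by (intro tendsto_intros S_right_derivative_zero assms)
  show "\<forall>\<^sub>F h in at_right 0. S \<tau> ((1 / h) *\<^sub>R (S h x - x)) = (1 / h) *\<^sub>R (S h (S \<tau> x) - S \<tau> x)"
    using eventually_at_right_less[of "0::real"]
  proof eventually_elim
    case (elim h)
    then have "S \<tau> (S h x) = S h (S \<tau> x)"
      using S_add[of \<tau> h x] S_add[of h \<tau> x] assms by (simp add: add.commute)
    then show ?case by (simp add: blinfun.scaleR_right blinfun.diff_right)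
  qed
qed

lemma S_D: "x \<in> D \<Longrightarrow> \<tau> \<ge> 0 \<Longrightarrow> S \<tau> x \<in> D"
  using S_shift gen unfolding generates_def by blast

lemma A_S: "x \<in> D \<Longrightarrow> \<tau> \<ge> 0 \<Longrightarrow> A (S \<tau> x) = S \<tau> (A x)"
  using tendsto_unique[OF _ S_right_derivative_zero[OF S_D] S_shift] by auto

lemma S_right_derivative:
  assumes "S \<tau> x \<in> D" "\<tau> \<ge> 0"
  shows "((\<lambda>h. (1 / h) *\<^sub>R (S (\<tau> + h) x - S \<tau> x)) \<longlongrightarrow> A (S \<tau> x)) (at_right 0)"
proof (rule Lim_transform_eventually)
  show "((\<lambda>h. (1 / h) *\<^sub>R (S h (S \<tau> x) - S \<tau> x)) \<longlongrightarrow> A (S \<tau> x)) (at_right 0)"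
    by (rule S_right_derivative_zero) fact
  show "\<forall>\<^sub>F h in at_right 0. (1 / h) *\<^sub>R (S h (S \<tau> x) - S \<tau> x) = (1 / h) *\<^sub>R (S (\<tau> + h) x - S \<tau> x)"
    using eventually_at_right_less[of "0::real"]
    by eventually_elim (use assms S_add[of _ \<tau> x] in \<open>simp add: add.commute\<close>)
qed

lemma norm_S_diff_le:
  assumes "x \<in> D" "h \<ge> 0"
  shows "norm (S h x - x) \<le> h * (exp (\<omega> * h) * norm (A x))"
proof -
  have "norm (S h x - S 0 x) \<le> (h - 0) * (exp (\<omega> * h) * norm (A x))"
  proof (rule right_derivative_bound)
    show "continuous_on {0..h} (\<lambda>\<tau>. S \<tau> x)"
      by (rule continuous_on_subset[OF continuous_on_S]) auto
    fix \<tau> :: real assume \<tau>: "0 < \<tau>" "\<tau> < h"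
    show "((\<lambda>s. (1 / s) *\<^sub>R (S (\<tau> + s) x - S \<tau> x)) \<longlongrightarrow> A (S \<tau> x)) (at_right 0)"
      using assms \<tau> by (intro S_right_derivative S_D) auto
    have "norm (A (S \<tau> x)) \<le> exp (\<omega> * \<tau>) * norm (A x)"
      using assms \<tau> norm_S_le by (simp add: A_S)
    also have "\<dots> \<le> exp (\<omega> * h) * norm (A x)"
      using \<tau> \<omega> by (intro mult_right_mono) (auto intro: mult_left_mono)
    finally show "norm (A (S \<tau> x)) \<le> exp (\<omega> * h) * norm (A x)" .
  qed (use assms in auto)
  then show ?thesis by (simp add: S_zero)
qed

text \<open>The right derivative of the remainder is \<open>S \<tau> (A x) - A x\<close>, which is
  of first order in \<tau> by the previous lemma applied to \<open>A x\<close>.\<close>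

lemma norm_S_taylor_le:
  assumes "x \<in> D" "A x \<in> D" "h \<ge> 0"
  shows "norm (S h x - x - h *\<^sub>R A x) \<le> h\<^sup>2 * (exp (\<omega> * h) * norm (A (A x)))"
proof -
  have "norm ((S h x - h *\<^sub>R A x) - (S 0 x - 0 *\<^sub>R A x)) \<le> (h - 0) * (h * (exp (\<omega> * h) * norm (A (A x))))"
  proof (rule right_derivative_bound)
    show "continuous_on {0..h} (\<lambda>\<tau>. S \<tau> x - \<tau> *\<^sub>R A x)"
      by (intro continuous_intros continuous_on_subset[OF continuous_on_S]) auto
    fix \<tau> :: real assume \<tau>: "0 < \<tau>" "\<tau> < h"
    have "((\<lambda>s. (1 / s) *\<^sub>R (S (\<tau> + s) x - S \<tau> x) - A x) \<longlongrightarrow> S \<tau> (A x) - A x) (at_right 0)"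
      using assms \<tau> S_right_derivative[of \<tau> x] by (intro tendsto_intros) (simp add: S_D A_S)
    moreover have "\<forall>\<^sub>F s::real in at_right 0. (1 / s) *\<^sub>R (S (\<tau> + s) x - S \<tau> x) - A x
        = (1 / s) *\<^sub>R ((S (\<tau> + s) x - (\<tau> + s) *\<^sub>R A x) - (S \<tau> x - \<tau> *\<^sub>R A x))"
      using eventually_at_right_less[of "0::real"]
      by eventually_elim (simp add: algebra_simps)
    ultimately show "((\<lambda>s. (1 / s) *\<^sub>R ((S (\<tau> + s) x - (\<tau> + s) *\<^sub>R A x) - (S \<tau> x - \<tau> *\<^sub>R A x))) \<longlongrightarrow> S \<tau> (A x) - A x) (at_right 0)"
      by (rule Lim_transform_eventually)
    have "norm (S \<tau> (A x) - A x) \<le> \<tau> * (exp (\<omega> * \<tau>) * norm (A (A x)))"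
      using assms \<tau> by (intro norm_S_diff_le) auto
    also have "\<dots> \<le> h * (exp (\<omega> * h) * norm (A (A x)))"
      using \<tau> \<omega> by (intro mult_mono) (auto intro: mult_left_mono)
    finally show "norm (S \<tau> (A x) - A x) \<le> h * (exp (\<omega> * h) * norm (A (A x)))" .
  qed (use assms in auto)
  then show ?thesis by (simp add: S_zero power2_eq_square algebra_simps)
qed

section \<open>Backward Euler steps \<open>E l = (I - A / l)^-1\<close> of length
  \<open>1 / l\<close>, and the exponential formula\<close>

definition E :: "real \<Rightarrow> 'a \<Rightarrow> 'a" where "E l x = l *\<^sub>R R (of_real l) x"

lemma E_diff: "E l (x - y) = E l x - E l y"
  by (simp add: E_def blinfun.diff_right algebra_simps)

lemma E_power: "(E l ^^ n) x = l ^ n *\<^sub>R Rp (of_real l) n x"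
  by (induction n) (auto simp: E_def blinfun.scaleR_right)

lemma E_D: "l \<ge> 0 \<Longrightarrow> E l x \<in> D"
  by (simp add: E_def D_scaleR R_D)

lemma A_E: "l \<ge> 0 \<Longrightarrow> x \<in> D \<Longrightarrow> A (E l x) = E l (A x)"
  by (simp add: E_def A_scaleR R_D R_A)

lemma E_power_A: "l \<ge> 0 \<Longrightarrow> x \<in> D \<Longrightarrow> (E l ^^ n) (A x) = A ((E l ^^ n) x)"
  using R_power_A[of x "of_real l" n] by (simp add: E_power A_scaleR)

lemma E_minus_id: "l \<ge> 0 \<Longrightarrow> x \<in> D \<Longrightarrow> E l x - x = R (of_real l) (A x)"
  using A_R[of "of_real l" x] by (simp add: E_def R_A cs_of_real)

lemma norm_E_minus_id_le: "l > \<omega> \<Longrightarrow> x \<in> D \<Longrightarrow> norm (E l x - x) \<le> norm (A x) / (l - \<omega>)"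
  using \<omega> by (simp add: E_minus_id norm_R_real_le)

lemma norm_E_power_le: "l > \<omega> \<Longrightarrow> norm ((E l ^^ n) x) \<le> (l / (l - \<omega>)) ^ n * norm x"
  using mult_left_mono[OF norm_R_power_le[of l n x], of "l ^ n"] \<omega>
  by (simp add: E_power power_divide)

text \<open>Consistency: the Euler step and the semigroup both agree with
  \<open>x + (1 / l) A x\<close> up to second order in \<open>1 / l\<close>. The condition
  \<open>l \<ge> 2 * \<omega>\<close> gives \<open>1 / (l - \<omega>) \<le> 2 / l\<close> and
  \<open>exp (\<omega> / l) \<le> exp 1\<close>.\<close>

lemma norm_E_S_diff_le:
  assumes l: "l \<ge> 2 * \<omega>" "l > 0" and x: "x \<in> D" "A x \<in> D"
  shows "norm (E l x - S (1 / l) x) \<le> (2 + exp 1) * norm (A (A x)) / l\<^sup>2"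
proof -
  have l\<omega>: "l > \<omega>" using l \<omega> by linarith
  have "E l x - x = (1 / l) *\<^sub>R E l (A x)"
    using l x by (simp add: E_minus_id) (simp add: E_def)
  then have "E l x - S (1 / l) x = (1 / l) *\<^sub>R (E l (A x) - A x) - (S (1 / l) x - x - (1 / l) *\<^sub>R A x)"
    by (simp add: algebra_simps)
  then have "norm (E l x - S (1 / l) x) \<le> norm ((1 / l) *\<^sub>R (E l (A x) - A x)) + norm (S (1 / l) x - x - (1 / l) *\<^sub>R A x)"
    by (simp only: norm_triangle_ineq4)
  also have "norm ((1 / l) *\<^sub>R (E l (A x) - A x)) = (1 / l) * norm (E l (A x) - A x)"
    using l by simp
  finally have "norm (E l x - S (1 / l) x) \<le> (1 / l) * norm (E l (A x) - A x) + norm (S (1 / l) x - x - (1 / l) *\<^sub>R A x)" .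
  also have "\<dots> \<le> (1 / l) * (2 / l * norm (A (A x))) + (1 / l)\<^sup>2 * (exp 1 * norm (A (A x)))"
  proof (intro add_mono mult_left_mono)
    have "1 / (l - \<omega>) \<le> 2 / l" using l l\<omega> \<omega> by (simp add: field_simps)
    then have "norm (A (A x)) * (1 / (l - \<omega>)) \<le> norm (A (A x)) * (2 / l)" by (intro mult_left_mono) auto
    then show "norm (E l (A x) - A x) \<le> 2 / l * norm (A (A x))"
      using norm_E_minus_id_le[OF l\<omega> x(2)] by (simp add: mult.commute)
    have "exp (\<omega> * (1 / l)) \<le> exp 1" using l \<omega> by (simp add: pos_divide_le_eq)
    then have "(1 / l)\<^sup>2 * (exp (\<omega> * (1 / l)) * norm (A (A x))) \<le> (1 / l)\<^sup>2 * (exp 1 * norm (A (A x)))"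
      by (intro mult_left_mono mult_right_mono) auto
    then show "norm (S (1 / l) x - x - (1 / l) *\<^sub>R A x) \<le> (1 / l)\<^sup>2 * (exp 1 * norm (A (A x)))"
      by (rule order_trans[OF norm_S_taylor_le[OF x, of "1 / l"], rotated]) (use l in simp)
  qed (use l in auto)
  also have "\<dots> = (2 + exp 1) * norm (A (A x)) / l\<^sup>2"
    by (simp add: power2_eq_square algebra_simps add_divide_distrib)
  finally show ?thesis .
qed

text \<open>The amplification over \<open>n\<close> backward Euler steps, as the reciprocal of the
  compound interest limit.\<close>

lemma inverse_power_limit:
  fixes c :: real
  shows "(\<lambda>n. (real n / (real n - c)) ^ n) \<longlonglongrightarrow> exp c"
proof (rule Lim_transform_eventually)
  have "(\<lambda>n. (1 + (- c) / real n) ^ n) \<longlonglongrightarrow> exp (- c)"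
    by (rule tendsto_exp_limit_sequentially)
  then have "(\<lambda>n. inverse ((1 + (- c) / real n) ^ n)) \<longlonglongrightarrow> inverse (exp (- c))"
    by (intro tendsto_intros) auto
  then show "(\<lambda>n. inverse ((1 + (- c) / real n) ^ n)) \<longlonglongrightarrow> exp c"
    by (simp add: exp_minus)
  show "\<forall>\<^sub>F n in sequentially. inverse ((1 + (- c) / real n) ^ n) = (real n / (real n - c)) ^ n"
    using eventually_gt_at_top[of 0]
  proof eventually_elim
    case (elim n)
    then have "1 + (- c) / real n = (real n - c) / real n" by (simp add: field_simps)
    then show ?case by (simp add: power_inverse[symmetric])
  qed
qed

text \<open>Stability plus consistency: each of the \<open>n\<close> steps errs by a multiple of
  \<open>1 / n^2\<close>, and the total amplification stays bounded, so the error is of order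
  \<open>1 / n\<close>.\<close>

lemma hille_exponential_formula:
  assumes x: "x \<in> D" "A x \<in> D" and \<sigma>: "\<sigma> > 0"
  shows "(\<lambda>n. (E (real n / \<sigma>) ^^ n) x) \<longlonglongrightarrow> S \<sigma> x"
proof -
  \<comment> \<open>Any number above the limit \<open>exp (\<omega> * \<sigma>)\<close> of the
    amplification factors bounds them eventually.\<close>
  define K where "K = exp (\<omega> * \<sigma>) + 1"
  define c where "c = K * ((2 + exp 1) * (exp (\<omega> * \<sigma>) * norm (A (A x)))) * \<sigma>\<^sup>2"
  have "(\<lambda>n. (real n / (real n - \<omega> * \<sigma>)) ^ n) \<longlonglongrightarrow> exp (\<omega> * \<sigma>)"
    by (rule inverse_power_limit)
  then have evK: "\<forall>\<^sub>F n in sequentially. (real n / (real n - \<omega> * \<sigma>)) ^ n < K"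
    by (rule order_tendstoD) (simp add: K_def)
  obtain n0 :: nat where n0: "2 * \<omega> * \<sigma> + 1 \<le> real n0" using real_arch_simple by blast
  have main: "norm ((E (real n / \<sigma>) ^^ n) x - S \<sigma> x) \<le> c / real n"
    if n: "(real n / (real n - \<omega> * \<sigma>)) ^ n < K" "n \<ge> n0" for n
  proof -
    define l where "l = real n / \<sigma>"
    have n1: "2 * \<omega> * \<sigma> + 1 \<le> real n" using n n0 by linarith
    then have npos: "real n > 0" using \<omega> \<sigma> mult_nonneg_nonneg[of "2 * \<omega>" \<sigma>] by linarith
    have l: "l > 0" "l \<ge> 2 * \<omega>" using npos n1 \<sigma> by (auto simp: l_def field_simps)
    then have l\<omega>: "l > \<omega>" using \<omega> by linarith
    have q: "l / (l - \<omega>) = real n / (real n - \<omega> * \<sigma>)"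
      using \<sigma> l\<omega> by (simp add: l_def field_simps)
    have q1: "l / (l - \<omega>) \<ge> 1" using l\<omega> \<omega> by (simp add: field_simps)
    define \<kappa> where "\<kappa> = (2 + exp 1) * (exp (\<omega> * \<sigma>) * norm (A (A x))) / l\<^sup>2"
    have "norm ((E l ^^ n) x - S (real n / l) x) \<le> real n * ((l / (l - \<omega>)) ^ n * \<kappa>)"
    proof (rule discrete_gronwall[of "\<lambda>k. norm ((E l ^^ k) x - S (real k / l) x)"])
      fix k assume k: "k < n"
      let ?y = "S (real k / l) x"
      have kl: "real k / l \<le> \<sigma>" "0 \<le> real k / l" using k l \<sigma> by (auto simp: l_def field_simps)
      \<comment> \<open>The exact orbit keeps the regularity of \<open>x\<close>, and its second
        derivative is controlled on the whole interval, so the local error has the same bound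
        \<kappa> at every step.\<close>
      have y: "?y \<in> D" "A ?y \<in> D" "A (A ?y) = S (real k / l) (A (A x))"
        using x kl by (auto simp: A_S S_D)
      have "S (real (Suc k) / l) x = S (1 / l) ?y"
        using S_add[of "1 / l" "real k / l" x] l by (simp add: add_divide_distrib)
      then have "(E l ^^ Suc k) x - S (real (Suc k) / l) x = E l ((E l ^^ k) x - ?y) + (E l ?y - S (1 / l) ?y)"
        by (simp add: E_diff)
      then have "norm ((E l ^^ Suc k) x - S (real (Suc k) / l) x) \<le> norm (E l ((E l ^^ k) x - ?y)) + norm (E l ?y - S (1 / l) ?y)"
        by (simp only: norm_triangle_ineq)
      also have "norm (E l ((E l ^^ k) x - ?y)) \<le> l / (l - \<omega>) * norm ((E l ^^ k) x - ?y)"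
        using norm_E_power_le[OF l\<omega>, of 1] by simp
      also have "norm (E l ?y - S (1 / l) ?y) \<le> (2 + exp 1) * norm (A (A ?y)) / l\<^sup>2"
        by (intro norm_E_S_diff_le l y)
      also have "\<dots> \<le> \<kappa>"
      proof -
        have "norm (A (A ?y)) \<le> exp (\<omega> * (real k / l)) * norm (A (A x))"
          unfolding y using kl by (intro norm_S_le)
        also have "\<dots> \<le> exp (\<omega> * \<sigma>) * norm (A (A x))"
          using mult_left_mono[OF kl(1) \<omega>] by (intro mult_right_mono) auto
        finally show ?thesis unfolding \<kappa>_def by (intro divide_right_mono mult_left_mono) auto
      qed
      finally show "norm ((E l ^^ Suc k) x - S (real (Suc k) / l) x) \<le> l / (l - \<omega>) * norm ((E l ^^ k) x - ?y) + \<kappa>"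
        by simp
    qed (use q1 in \<open>auto simp: \<kappa>_def S_zero\<close>)
    also have "\<dots> \<le> real n * (K * \<kappa>)"
      using n unfolding q by (intro mult_left_mono mult_right_mono) (auto simp: \<kappa>_def)
    also have "\<dots> = c / real n"
      using npos \<sigma> by (simp add: c_def \<kappa>_def l_def power2_eq_square field_simps)
    also have "real n / l = \<sigma>" using npos \<sigma> by (simp add: l_def)
    finally show ?thesis by (simp add: l_def)
  qed
  show ?thesis
  proof (rule LIM_zero_cancel, rule Lim_null_comparison)
    show "\<forall>\<^sub>F n in sequentially. norm ((E (real n / \<sigma>) ^^ n) x - S \<sigma> x) \<le> c / real n"
      using evK eventually_ge_at_top[of n0] by eventually_elim (rule main)
    show "(\<lambda>n. c / real n) \<longlonglongrightarrow> 0" by (rule lim_const_over_n)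
  qed
qed


text \<open>The discrete smoothing estimate. The binomial coefficient of the Cauchy estimate grows
  like \<open>n^2\<close> and cancels the surplus powers of \<open>l = n / \<sigma>\<close>, leaving
  a single \<open>1 / \<sigma>\<close>.\<close>

lemma norm_A_E_power_le:
  assumes \<sigma>: "\<sigma> > 0" and n: "n \<ge> 3" "real n > \<omega> * \<sigma> + 1"
  shows "norm (A ((E (real n / \<sigma>) ^^ n) y))
    \<le> 27 * (M0 + 1) * M0\<^sup>2 / \<sigma> * (real n / (real n - (\<omega> * \<sigma> + 1))) ^ n * norm y"
proof -
  define l where "l = real n / \<sigma>"
  \<comment> \<open>The radius stays \<open>1 / \<sigma>\<close> below the admissible limit: close
    enough for \<open>(l / r) ^ n\<close> to remain bounded as \<open>n\<close> grows, far enough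
    for \<open>l^2 - r^2\<close> to be at least \<open>l / \<sigma>\<close>.\<close>
  define r where "r = l - \<omega> - 1 / \<sigma>"
  define m where "m = n - 3"
  have nm: "n = m + 3" using n by (simp add: m_def)
  have r_eq: "r = (real n - (\<omega> * \<sigma> + 1)) / \<sigma>" using \<sigma> by (simp add: r_def l_def field_simps)
  have r: "0 < r" "r < l - \<omega>" using n \<sigma> by (auto simp: r_eq) (simp add: r_def flip: r_eq)
  have rl: "r < l" using r \<omega> by simp
  have l0: "l > 0" using rl r by simp
  have q: "l / r = real n / (real n - (\<omega> * \<sigma> + 1))" using \<sigma> by (simp add: r_eq l_def)
  let ?a = "norm (A (Rp (of_real l) n y))" and ?C = "(M0 + 1) * M0\<^sup>2 * norm y"
  define ch where "ch = real ((m + 2) choose 2)"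
  have C0: "?C \<ge> 0" using M0 by simp
  have ch: "ch = (real m + 2) * (real m + 1) / 2"
  proof -
    have "2 * ((m + 2) choose 2) = (m + 2) * (m + 1)"
      by (induction m) (simp_all add: numeral_2_eq_2)
    then have "real (2 * ((m + 2) choose 2)) = real ((m + 2) * (m + 1))" by (rule arg_cong)
    then show ?thesis unfolding ch_def by (simp only: of_nat_mult of_nat_add of_nat_numeral of_nat_1)
  qed
  have d: "l\<^sup>2 - r\<^sup>2 \<ge> l / \<sigma>"
  proof -
    have "l - r \<ge> 1 / \<sigma>" using \<omega> by (simp add: r_def)
    then have "(1 / \<sigma>) * l \<le> (l - r) * (l + r)" using r rl \<sigma> l0 by (intro mult_mono) auto
    then show ?thesis by (simp add: power2_eq_square algebra_simps)
  qed
  have "ch * r ^ m * ?a \<le> 3 * (M0 + 1) * M0\<^sup>2 / (l\<^sup>2 - r\<^sup>2) * norm y"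
    unfolding nm ch_def by (rule norm_A_R_power_le[OF r])
  also have "\<dots> = 3 * ?C / (l\<^sup>2 - r\<^sup>2)" by simp
  also have "\<dots> \<le> 3 * ?C / (l / \<sigma>)"
  proof (intro divide_left_mono d mult_pos_pos)
    show "l / \<sigma> > 0" using l0 \<sigma> by simp
    then show "l\<^sup>2 - r\<^sup>2 > 0" using d by linarith
  qed (use C0 in simp)
  finally have 1: "ch * r ^ m * ?a \<le> 3 * ?C * \<sigma> / l" by simp
  have ch0: "ch > 0" unfolding ch by simp
  have "?a \<le> 3 * ?C * \<sigma> / l / (ch * r ^ m)"
  proof -
    have "ch * r ^ m > 0" using ch0 r by simp
    then show ?thesis using 1 by (subst pos_le_divide_eq) (simp_all only: mult_ac)
  qed
  then have "l ^ n * ?a \<le> l ^ n * (3 * ?C * \<sigma> / l / (ch * r ^ m))"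
    using l0 by (intro mult_left_mono) auto
  also have "\<dots> = (l / r) ^ m * (3 * ?C) * (l\<^sup>2 * \<sigma> / ch)"
    using l0 r ch0 unfolding nm by (simp add: power_add power_divide power2_eq_square power3_eq_cube field_simps)
  \<comment> \<open>The 9 is the best constant in \<open>n^2 \<le> 9 * ch\<close>, attained at
    \<open>n = 3\<close>; with the 3 from the Cauchy estimate it makes the 27 of the result.\<close>
  also have "\<dots> \<le> (l / r) ^ n * (3 * ?C) * (9 / \<sigma>)"
  proof (intro mult_mono mult_nonneg_nonneg)
    show "(l / r) ^ m \<le> (l / r) ^ n" using r rl by (intro power_increasing) (auto simp: nm)
    have "l\<^sup>2 * \<sigma> = (real n)\<^sup>2 / \<sigma>" using \<sigma> by (simp add: l_def power2_eq_square)
    moreover have "(real n)\<^sup>2 \<le> 9 * ch"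
    proof -
      have "9 * ((real m + 2) * (real m + 1) / 2) - (real m + 3)\<^sup>2 = (7 * (real m)\<^sup>2 + 15 * real m) / 2"
        by (simp add: power2_eq_square field_simps)
      moreover have "\<dots> \<ge> 0" by simp
      ultimately have "(real m + 3)\<^sup>2 \<le> 9 * ((real m + 2) * (real m + 1) / 2)" by linarith
      then show ?thesis unfolding ch nm by (simp only: of_nat_add of_nat_numeral)
    qed
    ultimately show "l\<^sup>2 * \<sigma> / ch \<le> 9 / \<sigma>"
      using ch0 \<sigma> by (simp add: pos_divide_le_eq divide_right_mono)
  qed (use C0 r l0 \<sigma> M0 ch0 in auto)
  also have "\<dots> = 27 * (M0 + 1) * M0\<^sup>2 / \<sigma> * (l / r) ^ n * norm y" by (simp add: mult_ac)
  finally have "l ^ n * ?a \<le> 27 * (M0 + 1) * M0\<^sup>2 / \<sigma> * (l / r) ^ n * norm y" .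
  moreover have "norm (A ((E l ^^ n) y)) = l ^ n * ?a"
  proof -
    have "Rp (of_real l) (Suc (m + 2)) y \<in> D" using l0 by (simp add: R_D)
    then have "Rp (of_real l) n y \<in> D" by (simp add: nm numeral_3_eq_3 numeral_2_eq_2)
    then show ?thesis using l0 by (simp add: E_power A_scaleR)
  qed
  ultimately show ?thesis unfolding l_def[symmetric] q[symmetric] by simp
qed

section \<open>Smoothing for the semigroup: passage to the limit and extension by density\<close>

lemma E_tendsto_id:
  assumes "x \<in> D"
  shows "(\<lambda>n. E (\<omega> + 1 + real n) x) \<longlonglongrightarrow> x"
proof (rule LIM_zero_cancel, rule Lim_null_comparison)
  show "\<forall>\<^sub>F n in sequentially. norm (E (\<omega> + 1 + real n) x - x) \<le> norm (A x) / (1 + real n)"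
    using norm_E_minus_id_le[of "\<omega> + 1 + real _", OF _ assms] \<omega> by (intro always_eventually allI) (simp add: add.assoc)
  show "(\<lambda>n. norm (A x) / (1 + real n)) \<longlonglongrightarrow> 0"
    using LIMSEQ_Suc[OF lim_const_over_n[of "norm (A x)"]] by simp
qed

text \<open>\<open>E l\<close> gains one power of the domain and tends to the identity on
  \<open>D\<close>, so each domain is dense in the preceding one. The third power is needed because
  the exponential formula will be applied to \<open>A x\<close>.\<close>

lemma dense_D3: "closure {x \<in> D. A x \<in> D \<and> A (A x) \<in> D} = UNIV"
proof -
  let ?D2 = "{x \<in> D. A x \<in> D}" and ?D3 = "{x \<in> D. A x \<in> D \<and> A (A x) \<in> D}"
  let ?l = "\<lambda>n. \<omega> + 1 + real n"
  have l: "?l n \<ge> 0" for n using \<omega> by simp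
  have "D \<subseteq> closure ?D2"
  proof
    fix x assume x: "x \<in> D"
    have "E (?l n) x \<in> ?D2" for n using x l[of n] by (simp add: E_D A_E)
    then show "x \<in> closure ?D2" using E_tendsto_id[OF x] unfolding closure_sequential by (intro exI[of _ "\<lambda>n. E (?l n) x"] conjI allI) auto
  qed
  moreover have "?D2 \<subseteq> closure ?D3"
  proof
    fix x assume x: "x \<in> ?D2"
    have "E (?l n) x \<in> ?D3" for n using x l[of n] by (simp add: E_D A_E)
    then show "x \<in> closure ?D3" using E_tendsto_id[of x] x unfolding closure_sequential by (intro exI[of _ "\<lambda>n. E (?l n) x"] conjI allI) auto
  qed
  ultimately have "closure D \<subseteq> closure ?D3"
    by (meson closed_closure closure_minimal subset_trans)
  then show ?thesis using dense by auto
qed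

text \<open>The factor \<open>exp 1\<close> is the trace of the gap \<open>1 / \<sigma>\<close> in
  the radius: the powers \<open>(l / r) ^ n\<close> converge to
  \<open>exp (\<omega> * \<sigma> + 1)\<close>.\<close>

definition smoothing_constant :: real where
  "smoothing_constant = 27 * (M0 + 1) * M0\<^sup>2 * exp 1"

lemma norm_A_S_le_on_D3:
  assumes \<sigma>: "\<sigma> > 0" and x: "x \<in> D" "A x \<in> D" "A (A x) \<in> D"
  shows "norm (A (S \<sigma> x)) \<le> smoothing_constant * exp (\<omega> * \<sigma>) / \<sigma> * norm x"
proof (rule tendsto_le[OF sequentially_bot])
  have "(\<lambda>n. (E (real n / \<sigma>) ^^ n) (A x)) \<longlonglongrightarrow> S \<sigma> (A x)"
    by (rule hille_exponential_formula) fact+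
  then show "(\<lambda>n. norm ((E (real n / \<sigma>) ^^ n) (A x))) \<longlonglongrightarrow> norm (A (S \<sigma> x))"
    using \<sigma> x by (simp add: A_S tendsto_norm)
  have "(\<lambda>n. 27 * (M0 + 1) * M0\<^sup>2 / \<sigma> * (real n / (real n - (\<omega> * \<sigma> + 1))) ^ n * norm x)
    \<longlonglongrightarrow> 27 * (M0 + 1) * M0\<^sup>2 / \<sigma> * exp (\<omega> * \<sigma> + 1) * norm x"
    by (intro tendsto_intros inverse_power_limit)
  then show "(\<lambda>n. 27 * (M0 + 1) * M0\<^sup>2 / \<sigma> * (real n / (real n - (\<omega> * \<sigma> + 1))) ^ n * norm x)
    \<longlonglongrightarrow> smoothing_constant * exp (\<omega> * \<sigma>) / \<sigma> * norm x"
    by (simp add: smoothing_constant_def exp_add mult_ac)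
  obtain n0 :: nat where n0: "\<omega> * \<sigma> + 1 < real n0" using reals_Archimedean2 by blast
  show "\<forall>\<^sub>F n in sequentially. norm ((E (real n / \<sigma>) ^^ n) (A x))
     \<le> 27 * (M0 + 1) * M0\<^sup>2 / \<sigma> * (real n / (real n - (\<omega> * \<sigma> + 1))) ^ n * norm x"
    using eventually_ge_at_top[of "max 3 n0"]
  proof eventually_elim
    case (elim n)
    then have n: "n \<ge> 3" "real n > \<omega> * \<sigma> + 1" using n0 by auto
    show ?case using norm_A_E_power_le[OF \<sigma> n] \<sigma> x by (simp add: E_power_A)
  qed
qed

text \<open>Density argument: the estimate on differences makes the images under
  \<open>A S(\<sigma>)\<close> of an approximating sequence Cauchy, and closedness of
  \<open>A\<close> identifies the limit.\<close>

lemma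
  assumes \<sigma>: "\<sigma> > 0"
  shows S_in_D: "S \<sigma> x \<in> D"
    and norm_A_S_le: "norm (A (S \<sigma> x)) \<le> smoothing_constant * exp (\<omega> * \<sigma>) / \<sigma> * norm x"
proof -
  let ?D3 = "{x \<in> D. A x \<in> D \<and> A (A x) \<in> D}"
  let ?K = "smoothing_constant * exp (\<omega> * \<sigma>) / \<sigma>"
  have K: "?K \<ge> 0" using M0 \<sigma> by (simp add: smoothing_constant_def)
  obtain f where f: "\<And>n. f n \<in> ?D3" "f \<longlonglongrightarrow> x"
    using dense_D3 closure_sequential[of x ?D3] by auto
  have fD: "f n \<in> D" for n using f(1) by simp
  have SfD: "S \<sigma> (f n) \<in> D" for n using fD \<sigma> by (intro S_D) auto
  have diff: "norm (A (S \<sigma> (f m)) - A (S \<sigma> (f n))) \<le> ?K * norm (f m - f n)" for m n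
  proof -
    have "f m - f n \<in> ?D3" using f(1)[of m] f(1)[of n] by (auto simp: D_diff A_diff)
    then have "norm (A (S \<sigma> (f m - f n))) \<le> ?K * norm (f m - f n)"
      using \<sigma> by (intro norm_A_S_le_on_D3) auto
    then show ?thesis by (simp add: blinfun.diff_right A_diff[OF SfD SfD])
  qed
  have "Cauchy (\<lambda>n. A (S \<sigma> (f n)))"
  proof (rule metric_CauchyI)
    fix e :: real assume e: "e > 0"
    have "Cauchy f" using f(2) by (simp add: LIMSEQ_imp_Cauchy)
    then obtain N where N: "\<And>m n. m \<ge> N \<Longrightarrow> n \<ge> N \<Longrightarrow> dist (f m) (f n) < e / (?K + 1)"
      using metric_CauchyD[of f "e / (?K + 1)"] e K by (metis add_nonneg_pos divide_pos_pos zero_less_one)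
    have "dist (A (S \<sigma> (f m))) (A (S \<sigma> (f n))) < e" if "m \<ge> N" "n \<ge> N" for m n
    proof -
      have "dist (A (S \<sigma> (f m))) (A (S \<sigma> (f n))) \<le> ?K * dist (f m) (f n)"
        using diff by (simp add: dist_norm)
      also have "\<dots> \<le> (?K + 1) * dist (f m) (f n)" by (intro mult_right_mono) auto
      also have "\<dots> < e" using N[OF that] K by (simp add: pos_less_divide_eq mult.commute add_nonneg_pos)
      finally show ?thesis .
    qed
    then show "\<exists>M. \<forall>m\<ge>M. \<forall>n\<ge>M. dist (A (S \<sigma> (f m))) (A (S \<sigma> (f n))) < e" by blast
  qed
  then obtain y where y: "(\<lambda>n. A (S \<sigma> (f n))) \<longlonglongrightarrow> y"
    using Cauchy_convergent convergent_def by blast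
  have Sf: "(\<lambda>n. S \<sigma> (f n)) \<longlonglongrightarrow> S \<sigma> x" by (intro tendsto_intros f)
  \<comment> \<open>closedness of \<open>A\<close>, from the boundedness of \<open>R 0 = - A\<^sup>-\<^sup>1\<close>\<close>
  have "R 0 (- A (S \<sigma> (f n))) = S \<sigma> (f n)" for n
    using R_inv[of 0 "S \<sigma> (f n)"] SfD by simp
  moreover have "(\<lambda>n. R 0 (- A (S \<sigma> (f n)))) \<longlonglongrightarrow> R 0 (- y)" by (intro tendsto_intros y)
  ultimately have Sx: "S \<sigma> x = R 0 (- y)" using Sf LIMSEQ_unique by fastforce
  then show "S \<sigma> x \<in> D" by (simp add: R_D)
  have "A (S \<sigma> x) = y" unfolding Sx by (simp add: A_R)
  moreover have "norm y \<le> ?K * norm x"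
  proof (rule tendsto_le[OF sequentially_bot])
    show "(\<lambda>n. ?K * norm (f n)) \<longlonglongrightarrow> ?K * norm x" by (intro tendsto_intros f)
    show "(\<lambda>n. norm (A (S \<sigma> (f n)))) \<longlonglongrightarrow> norm y" by (intro tendsto_intros y)
    show "\<forall>\<^sub>F n in sequentially. norm (A (S \<sigma> (f n))) \<le> ?K * norm (f n)"
      using f(1) \<sigma> by (intro always_eventually allI norm_A_S_le_on_D3) auto
  qed
  ultimately show "norm (A (S \<sigma> x)) \<le> ?K * norm x" by simp
qed

end

section \<open>Evolution families and densely defined bounds\<close>

text \<open>A classical solution lies in \<open>D\<close> at all later times and converges to its
  initial value, so the dense set of initial values is contained in the closure of
  \<open>D\<close>.\<close>

lemma evolution_family_dense_domain:
  fixes U :: "real \<Rightarrow> real \<Rightarrow> ('a::banach \<Rightarrow>\<^sub>L 'a)"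
  assumes "evolution_family D A U"
  shows "closure D = UNIV"
proof -
  obtain Y where Y: "closure Y = UNIV" "\<And>s x. x \<in> Y \<Longrightarrow> classical_solution D A s x (\<lambda>t. U t s x)"
    using assms by (auto simp: evolution_family_def)
  have "Y \<subseteq> closure D"
  proof
    fix x assume "x \<in> Y"
    then have sol: "classical_solution D A 0 x (\<lambda>t. U t 0 x)" by (rule Y)
    have "((\<lambda>t. U t 0 x) \<longlongrightarrow> U 0 0 x) (at 0 within {0..})"
      using sol unfolding classical_solution_def continuous_on_def by (meson atLeast_iff order_refl)
    then have "((\<lambda>t. U t 0 x) \<longlongrightarrow> x) (at_right 0)"
      using sol by (simp add: classical_solution_def) (erule tendsto_within_subset, auto)
    moreover have "\<forall>\<^sub>F t in at_right 0. U t 0 x \<in> closure D"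
      using eventually_at_right_less[of "0::real"]
      by eventually_elim (use sol closure_subset in \<open>auto simp: classical_solution_def\<close>)
    ultimately show "x \<in> closure D"
      by (intro Lim_in_closed_set[of "closure D"]) auto
  qed
  then have "closure Y \<subseteq> closure D" by (rule closure_minimal) simp
  then show ?thesis using Y by auto
qed

lemma norm_blinfun_bound_dense:
  fixes W :: "'a::real_normed_vector \<Rightarrow>\<^sub>L 'b::real_normed_vector"
  assumes "closure Y = UNIV" "c \<ge> 0" "\<And>x. x \<in> Y \<Longrightarrow> norm (W x) \<le> c * norm x"
  shows "norm W \<le> c"
proof (rule norm_blinfun_bound)
  fix x
  have "closed {x. norm (W x) \<le> c * norm x}" by (intro closed_Collect_le continuous_intros)
  then have "closure Y \<subseteq> {x. norm (W x) \<le> c * norm x}" using assms by (intro closure_minimal) auto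
  then show "norm (W x) \<le> c * norm x" using assms(1) by auto
qed fact

text \<open>A modulus of continuity with exponent above one forces all right derivatives to vanish.
  This settles the case \<alpha> \<ge> 1 of the theorem.\<close>

lemma superlinear_modulus_constant:
  fixes p :: "real \<Rightarrow> 'a::real_normed_vector"
  assumes "a \<le> b" "\<beta> > 1" and le: "\<And>s t. a \<le> s \<Longrightarrow> s \<le> t \<Longrightarrow> t \<le> b \<Longrightarrow> norm (p t - p s) \<le> B * (t - s) powr \<beta>"
  shows "p b = p a"
proof -
  have "norm (p b - p a) \<le> (b - a) * 0"
  proof (rule right_derivative_bound)
    have dist_p: "dist (p x) (p y) \<le> B * \<bar>x - y\<bar> powr \<beta>" if "x \<in> {a..b}" "y \<in> {a..b}" for x y
      using that le[of x y] le[of y x] by (cases "x \<le> y") (auto simp: dist_norm norm_minus_commute abs_minus_commute)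
    show "continuous_on {a..b} p"
      unfolding continuous_on_def
    proof
      fix x assume x: "x \<in> {a..b}"
      have "((\<lambda>y. B * \<bar>y - x\<bar> powr \<beta>) \<longlongrightarrow> B * \<bar>x - x\<bar> powr \<beta>) (at x within {a..b})"
        using assms(2) by (intro tendsto_intros) auto
      then have "((\<lambda>y. B * \<bar>y - x\<bar> powr \<beta>) \<longlongrightarrow> 0) (at x within {a..b})" by simp
      moreover have "\<forall>\<^sub>F y in at x within {a..b}. norm (dist (p y) (p x)) \<le> B * \<bar>y - x\<bar> powr \<beta>"
        using x by (auto simp: eventually_at_filter intro!: always_eventually dist_p)
      ultimately show "(p \<longlongrightarrow> p x) (at x within {a..b})"
        unfolding tendsto_dist_iff[of p] by (rule Lim_null_comparison[rotated])
    qed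
    fix x assume x: "a < x" "x < b"
    have "((\<lambda>s. B * s powr (\<beta> - 1)) \<longlongrightarrow> B * 0 powr (\<beta> - 1)) (at_right 0)"
      using assms(2) by (intro tendsto_intros) (auto simp: eventually_at_filter)
    then have "((\<lambda>s. B * s powr (\<beta> - 1)) \<longlongrightarrow> 0) (at_right 0)" by simp
    moreover have "\<forall>\<^sub>F s in at_right 0. norm ((1 / s) *\<^sub>R (p (x + s) - p x)) \<le> B * s powr (\<beta> - 1)"
    proof -
      have "\<forall>\<^sub>F s in at_right 0. 0 < s \<and> s < b - x"
        using x by (auto simp: eventually_at_right_field intro!: exI[of _ "b - x"])
      then show ?thesis
      proof eventually_elim
        case (elim s)
        then have "norm (p (x + s) - p x) \<le> B * s powr \<beta>" using le[of x "x + s"] x by simp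
        then show ?case using elim by (simp add: powr_diff divide_right_mono)
      qed
    qed
    ultimately show "((\<lambda>s. (1 / s) *\<^sub>R (p (x + s) - p x)) \<longlongrightarrow> 0) (at_right 0)"
      by (rule Lim_null_comparison[rotated])
  qed (use assms in auto)
  then show ?thesis by simp
qed

lemma derivative_imp_right_derivative:
  assumes "(u has_vector_derivative d) (at t)"
  shows "((\<lambda>h. (1 / h) *\<^sub>R (u (t + h) - u t)) \<longlongrightarrow> d) (at_right 0)"
proof -
  have "((\<lambda>h. norm (u (t + h) - u t - h *\<^sub>R d) / norm h) \<longlongrightarrow> 0) (at_right 0)"
    using assms unfolding has_vector_derivative_def has_derivative_at
    by (auto intro: tendsto_within_subset)
  moreover have "\<forall>\<^sub>F h in at_right 0. norm ((1 / h) *\<^sub>R (u (t + h) - u t) - d) \<le> norm (u (t + h) - u t - h *\<^sub>R d) / norm h"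
    using eventually_at_right_less[of "0::real"]
  proof eventually_elim
    case (elim h)
    then have "(1 / h) *\<^sub>R (u (t + h) - u t) - d = (1 / h) *\<^sub>R (u (t + h) - u t - h *\<^sub>R d)"
      by (simp add: algebra_simps)
    then show ?case using elim by simp
  qed
  ultimately show ?thesis by (intro LIM_zero_cancel[of _ d]) (rule Lim_null_comparison)
qed

section \<open>Comparison with the frozen semigroup\<close>

text \<open>The difference \<open>w\<close> of the solution and the frozen semigroup orbit satisfies
\<open>w(\<tau> + s) = S \<tau> s (w \<tau>) + s (A \<tau> - A t)(S t (\<tau> - t) (u t)) + o(s)\<close>, so
the exponential bound on \<open>S \<tau>\<close> gives a Dini inequality for its norm.\<close>

lemma frozen_step_error:
  fixes u :: "real \<Rightarrow> 'a::banach"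
  assumes sg: "\<And>\<tau>. resolvent_semigroup J D (A \<tau>) (S \<tau>) M0 \<omega>"
    and h: "0 \<le> h" and g: "0 \<le> g"
    and cont: "continuous_on {t..t + h} u"
    and sol: "\<And>\<tau>. t < \<tau> \<Longrightarrow> \<tau> < t + h \<Longrightarrow> u \<tau> \<in> D \<and> (u has_vector_derivative A \<tau> (u \<tau>)) (at \<tau>)"
    and pert: "\<And>\<tau>. t < \<tau> \<Longrightarrow> \<tau> < t + h \<Longrightarrow> norm (A \<tau> (S t (\<tau> - t) (u t)) - A t (S t (\<tau> - t) (u t))) \<le> g"
  shows "norm (u (t + h) - S t h (u t)) \<le> exp (\<omega> * h) * (h * g)"
proof -
  define v where "v \<tau> = S t (\<tau> - t) (u t)" for \<tau>
  define w where "w \<tau> = u \<tau> - v \<tau>" for \<tau>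
  interpret F: resolvent_semigroup J D "A t" "S t" M0 \<omega> by (rule sg)
  have vcont: "continuous_on {t..t + h} v"
    unfolding v_def
    by (rule continuous_on_compose2[OF F.continuous_on_S]) (auto intro!: continuous_intros)
  have "norm (w (t + h)) \<le> exp (\<omega> * (t + h - t)) * (norm (w t) + (t + h - t) * g)"
  proof (rule right_dini_gronwall)
    show "continuous_on {t..t + h} (\<lambda>\<tau>. norm (w \<tau>))"
      unfolding w_def by (intro continuous_intros cont vcont)
    fix \<tau> \<epsilon> :: real assume \<tau>: "t < \<tau>" "\<tau> < t + h" and \<epsilon>: "\<epsilon> > 0"
    interpret G: resolvent_semigroup J D "A \<tau>" "S \<tau>" M0 \<omega> by (rule sg)
    have vD: "v \<tau> \<in> D" unfolding v_def using \<tau> by (intro F.S_in_D) auto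
    have uD: "u \<tau> \<in> D" using sol \<tau> by simp
    have wD: "w \<tau> \<in> D" unfolding w_def by (intro G.D_diff uD vD)
    have "((\<lambda>s. (1 / s) *\<^sub>R (u (\<tau> + s) - u \<tau>)) \<longlongrightarrow> A \<tau> (u \<tau>)) (at_right 0)"
      using sol \<tau> by (intro derivative_imp_right_derivative) auto
    moreover have "((\<lambda>s. (1 / s) *\<^sub>R (v (\<tau> + s) - v \<tau>)) \<longlongrightarrow> A t (v \<tau>)) (at_right 0)"
      using F.S_right_derivative[of "\<tau> - t" "u t"] vD \<tau> by (simp add: v_def algebra_simps)
    moreover have "((\<lambda>s. (1 / s) *\<^sub>R (S \<tau> s (w \<tau>) - w \<tau>)) \<longlongrightarrow> A \<tau> (w \<tau>)) (at_right 0)"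
      by (rule G.S_right_derivative_zero[OF wD])
    ultimately have lim: "((\<lambda>s. norm ((1 / s) *\<^sub>R (u (\<tau> + s) - u \<tau>) - (1 / s) *\<^sub>R (v (\<tau> + s) - v \<tau>) - (1 / s) *\<^sub>R (S \<tau> s (w \<tau>) - w \<tau>)))
        \<longlongrightarrow> norm (A \<tau> (u \<tau>) - A t (v \<tau>) - A \<tau> (w \<tau>))) (at_right 0)"
      by (intro tendsto_intros)
    have limit: "A \<tau> (u \<tau>) - A t (v \<tau>) - A \<tau> (w \<tau>) = A \<tau> (v \<tau>) - A t (v \<tau>)"
      using G.A_diff[OF uD vD] by (simp add: w_def)
    have "\<forall>\<^sub>F s in at_right 0. norm ((1 / s) *\<^sub>R (u (\<tau> + s) - u \<tau>) - (1 / s) *\<^sub>R (v (\<tau> + s) - v \<tau>) - (1 / s) *\<^sub>R (S \<tau> s (w \<tau>) - w \<tau>)) < g + \<epsilon>"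
      by (rule order_tendstoD(2)[OF lim[unfolded limit]]) (use pert[OF \<tau>, folded v_def] \<epsilon> in linarith)
    then show "\<forall>\<^sub>F s in at_right 0. norm (w (\<tau> + s)) \<le> exp (\<omega> * s) * norm (w \<tau>) + s * (g + \<epsilon>)"
      using eventually_at_right_less[of "0::real"]
    proof eventually_elim
      case (elim s)
      have "(1 / s) *\<^sub>R (u (\<tau> + s) - u \<tau>) - (1 / s) *\<^sub>R (v (\<tau> + s) - v \<tau>) - (1 / s) *\<^sub>R (S \<tau> s (w \<tau>) - w \<tau>)
          = (1 / s) *\<^sub>R (w (\<tau> + s) - S \<tau> s (w \<tau>))"
        by (simp add: w_def algebra_simps)
      then have "norm (w (\<tau> + s) - S \<tau> s (w \<tau>)) / s < g + \<epsilon>" using elim by simp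
      then have "norm (w (\<tau> + s) - S \<tau> s (w \<tau>)) \<le> s * (g + \<epsilon>)"
        using elim by (simp add: pos_divide_less_eq mult.commute)
      moreover have "norm (S \<tau> s (w \<tau>)) \<le> exp (\<omega> * s) * norm (w \<tau>)"
        using elim by (intro G.norm_S_le) auto
      moreover have "norm (w (\<tau> + s)) \<le> norm (S \<tau> s (w \<tau>)) + norm (w (\<tau> + s) - S \<tau> s (w \<tau>))"
        by (metis norm_triangle_sub)
      ultimately show ?case by linarith
    qed
  qed (use h g F.\<omega> in auto)
  then show ?thesis by (simp add: w_def v_def F.S_zero)
qed

lemma frozen_perturbation_bound:
  fixes A :: "real \<Rightarrow> 'a::banach \<Rightarrow> 'a"
  assumes sg: "resolvent_semigroup J D (A t) (S t) M0 \<omega>"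
    and \<alpha>: "0 \<le> \<alpha>" "\<alpha> < 1" "\<alpha> < \<beta>" and C: "C > 0"
    and H: "\<And>x. x \<in> D \<Longrightarrow> norm (A \<tau> x - A t x) \<le> C * (\<tau> - t) powr \<beta> * norm (A t x) powr \<alpha> * norm x powr (1 - \<alpha>)"
    and \<tau>: "t < \<tau>" "\<tau> \<le> t + h" "h \<le> T"
  shows "norm (A \<tau> (S t (\<tau> - t) y) - A t (S t (\<tau> - t) y))
    \<le> C * (27 * (M0 + 1) * M0\<^sup>2 * exp 1) powr \<alpha> * exp (\<omega> * T) * h powr (\<beta> - \<alpha>) * norm y"
proof -
  interpret F: resolvent_semigroup J D "A t" "S t" M0 \<omega> by (rule sg)
  define s where "s = \<tau> - t"
  define K where "K = F.smoothing_constant"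
  define e where "e = exp (\<omega> * T)"
  let ?v = "S t s y"
  have s: "s > 0" "s \<le> h" "s \<le> T" using \<tau> by (auto simp: s_def)
  have K0: "K \<ge> 0" using F.M0 by (simp add: K_def F.smoothing_constant_def)
  have es: "exp (\<omega> * s) \<le> e" using mult_left_mono[OF s(3) F.\<omega>] by (simp add: e_def)
  have e0: "e > 0" by (simp add: e_def)
  have Av: "norm (A t ?v) \<le> K * e / s * norm y"
    by (rule order_trans[OF F.norm_A_S_le[OF s(1)]])
      (use es s K0 in \<open>auto simp: K_def intro!: mult_right_mono divide_right_mono mult_left_mono\<close>)
  have v: "norm ?v \<le> e * norm y"
    by (rule order_trans[OF F.norm_S_le]) (use es s in \<open>auto intro: mult_right_mono\<close>)
  have "norm (A \<tau> ?v - A t ?v) \<le> C * s powr \<beta> * norm (A t ?v) powr \<alpha> * norm ?v powr (1 - \<alpha>)"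
    unfolding s_def using \<tau> by (intro H F.S_in_D) auto
  also have "\<dots> \<le> C * s powr \<beta> * (K * e / s * norm y) powr \<alpha> * (e * norm y) powr (1 - \<alpha>)"
    using \<alpha> C Av v s by (intro mult_mono powr_mono2 mult_nonneg_nonneg) auto
  also have "\<dots> = C * K powr \<alpha> * (e powr \<alpha> * e powr (1 - \<alpha>)) * (s powr \<beta> / s powr \<alpha>) * (norm y powr \<alpha> * norm y powr (1 - \<alpha>))"
    using K0 e0 s by (simp add: powr_mult powr_divide)
  also have "\<dots> = C * K powr \<alpha> * e * s powr (\<beta> - \<alpha>) * norm y"
    using e0 by (simp add: powr_add[symmetric] powr_diff)
  also have "\<dots> \<le> C * K powr \<alpha> * e * h powr (\<beta> - \<alpha>) * norm y"
    using C e0 s \<alpha> by (intro mult_right_mono mult_left_mono powr_mono2) auto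
  finally show ?thesis by (simp add: s_def K_def e_def F.smoothing_constant_def)
qed

section \<open>The two cases for \<alpha> and the summation of the local errors\<close>

theorem mainTheorem11:
  fixes J :: "'a::banach \<Rightarrow>\<^sub>L 'a"
    and D :: "'a set"
    and A :: "real \<Rightarrow> 'a \<Rightarrow> 'a"
    and S :: "real \<Rightarrow> real \<Rightarrow> ('a \<Rightarrow>\<^sub>L 'a)"
    and U :: "real \<Rightarrow> real \<Rightarrow> ('a \<Rightarrow>\<^sub>L 'a)"
    and M0 \<omega> L \<theta> \<alpha> \<beta> C :: real
  assumes cplx: "complex_structure J"
    and lin: "\<And>t. lin_op J D (A t)"
    and P2_sect: "\<And>t. sectorial J D (A t)"
    and P2_gen: "\<And>t. generates D (A t) (S t)"
    and P2_M0: "M0 \<ge> 1"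
    and P2_res: "\<And>t z. Re z \<ge> 0 \<Longrightarrow>
        \<exists>R. resolvent_op J D (A t) z R \<and> norm R \<le> M0 / (cmod z + 1)"
    and P2_exp: "\<And>t \<tau>. \<tau> \<ge> 0 \<Longrightarrow> norm (S t \<tau>) \<le> exp (\<omega> * \<tau>)"
    and P3: "L \<ge> 0" "0 < \<theta>" "\<theta> \<le> 1"
      "\<And>t s x. x \<in> D \<Longrightarrow> norm (A t x - A s x) \<le> L * \<bar>t - s\<bar> powr \<theta> * norm (A 0 x)"
    and H: "0 \<le> \<alpha>" "\<alpha> < \<beta>" "C > 0"
      "\<And>x s \<tau> t. x \<in> D \<Longrightarrow> s \<le> \<tau> \<Longrightarrow> \<tau> \<le> t \<Longrightarrow>
         norm (A t x - A s x) \<le> C * \<bar>t - s\<bar> powr \<beta> * norm (A \<tau> x) powr \<alpha> * norm x powr (1 - \<alpha>)"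
    and evol: "evolution_family D A U"
    and evol_bd: "\<And>t s. s \<le> t \<Longrightarrow> norm (U t s) \<le> exp (\<omega> * (t - s))"
  shows "\<forall>T>0. \<exists>CT. \<forall>M::nat. M \<ge> 1 \<longrightarrow>
     norm (U T 0 - prodL (\<lambda>k. S (real k * (T / real M)) (T / real M)) M)
       \<le> CT * (T / real M) powr (\<beta> - \<alpha>)"
proof (intro allI impI)
  fix T :: real assume T: "T > 0"
  \<comment> \<open>A nonnegative growth bound makes the exponential factors monotone in time, so
    all of them can be replaced by their values at \<open>T\<close>.\<close>
  define \<omega>' where "\<omega>' = max \<omega> 0"
  have \<omega>': "\<omega>' \<ge> 0" "\<omega> \<le> \<omega>'" by (auto simp: \<omega>'_def)
  have exp_le: "exp (\<omega> * \<tau>) \<le> exp (\<omega>' * \<tau>)" if "\<tau> \<ge> 0" for \<tau>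
    using mult_right_mono[OF \<omega>'(2) that] by simp
  have sg: "resolvent_semigroup J D (A t) (S t) M0 \<omega>'" for t
  proof
    show "norm (S t \<tau>) \<le> exp (\<omega>' * \<tau>)" if "\<tau> \<ge> 0" for \<tau>
      using P2_exp[OF that] exp_le[OF that] by (rule order_trans)
    show "closure D = UNIV" by (rule evolution_family_dense_domain[OF evol])
  qed (fact cplx lin P2_gen P2_M0 P2_res \<omega>')+
  define G where "G = C * (27 * (M0 + 1) * M0\<^sup>2 * exp 1) powr \<alpha> * exp (\<omega>' * T)"
  have G0: "G \<ge> 0" using H P2_M0 by (simp add: G_def)
  have pert: "norm (A \<tau> (S t (\<tau> - t) y) - A t (S t (\<tau> - t) y)) \<le> G * h powr (\<beta> - \<alpha>) * norm y"
    if \<tau>: "t < \<tau>" "\<tau> \<le> t + h" "h \<le> T" for t \<tau> h y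
  proof (cases "\<alpha> < 1")
    case True
    have "norm (A \<tau> x - A t x) \<le> C * (\<tau> - t) powr \<beta> * norm (A t x) powr \<alpha> * norm x powr (1 - \<alpha>)" if "x \<in> D" for x
      using H(4)[OF that, of t t \<tau>] \<tau> by simp
    then show ?thesis unfolding G_def
      by (rule frozen_perturbation_bound[OF sg H(1) True H(2,3) _ \<tau>])
  next
    case False
    interpret F: resolvent_semigroup J D "A t" "S t" M0 \<omega>' by (rule sg)
    define x where "x = S t (\<tau> - t) y"
    have x: "x \<in> D" unfolding x_def using \<tau> by (intro F.S_in_D) auto
    \<comment> \<open>Here \<beta> > 1. (P3) bounds \<open>norm (A r x)\<close> uniformly for
      \<open>r\<close> between \<open>t\<close> and \<tau>, so (H) gives
      \<open>r \<mapsto> A r x\<close> a modulus of exponent \<beta> with one fixed constant, and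
      the perturbation vanishes.\<close>
    define Q where "Q = norm (A t x) + L * (\<tau> - t) powr \<theta> * norm (A 0 x)"
    have Q: "norm (A r x) \<le> Q" if "t \<le> r" "r \<le> \<tau>" for r
    proof -
      have "norm (A r x - A t x) \<le> L * (r - t) powr \<theta> * norm (A 0 x)"
        using P3(4)[OF x, of r t] that by simp
      also have "\<dots> \<le> L * (\<tau> - t) powr \<theta> * norm (A 0 x)"
        using P3 that by (intro mult_right_mono mult_left_mono powr_mono2) auto
      finally show ?thesis using norm_triangle_sub[of "A r x" "A t x"] by (simp add: Q_def)
    qed
    have "A \<tau> x = A t x"
    proof (rule superlinear_modulus_constant)
      fix r s assume r: "t \<le> r" "r \<le> s" "s \<le> \<tau>"
      have "norm (A s x - A r x) \<le> C * (s - r) powr \<beta> * norm (A r x) powr \<alpha> * norm x powr (1 - \<alpha>)"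
        using H(4)[OF x, of r r s] r by simp
      also have "\<dots> \<le> C * (s - r) powr \<beta> * Q powr \<alpha> * norm x powr (1 - \<alpha>)"
        using H r by (intro mult_right_mono mult_left_mono powr_mono2 Q) auto
      finally show "norm (A s x - A r x) \<le> C * Q powr \<alpha> * norm x powr (1 - \<alpha>) * (s - r) powr \<beta>"
        by (simp add: mult_ac)
    qed (use \<tau> False H in auto)
    then show ?thesis using G0 by (simp add: x_def)
  qed
  obtain Y where Y: "closure Y = UNIV" "\<And>s x. x \<in> Y \<Longrightarrow> classical_solution D A s x (\<lambda>t. U t s x)"
    using evol by (auto simp: evolution_family_def)
  \<comment> \<open>\<open>T\<close> is the number of steps times their length. The three
    exponentials are the amplification over all steps, the Gronwall factor of one step, and the
    growth of the solution up to time \<open>T\<close>.\<close>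
  let ?CT = "T * exp (\<omega>' * T) * exp (\<omega>' * T) * exp (\<omega>' * T) * G"
  show "\<exists>CT. \<forall>M::nat. M \<ge> 1 \<longrightarrow> norm (U T 0 - prodL (\<lambda>k. S (real k * (T / real M)) (T / real M)) M)
       \<le> CT * (T / real M) powr (\<beta> - \<alpha>)"
  \<comment> \<open>Orbits are known to be classical solutions only for starting values in
    \<open>Y\<close>; as \<open>?CT\<close> does not depend on \<open>x\<close>, a bound on this
    dense set is a bound on the operator norm.\<close>
  proof (intro exI[of _ ?CT] allI impI norm_blinfun_bound_dense[OF Y(1)])
    fix M :: nat assume M: "M \<ge> 1"
    define h where "h = T / real M"
    have h: "h > 0" "h \<le> T" "real M * h = T" using M T by (auto simp: h_def field_simps)
    let ?P = "\<lambda>n. prodL (\<lambda>k. S (real k * h) h) n"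
    fix x assume x: "x \<in> Y"
    define u where "u t = U t 0 x" for t
    have sol: "classical_solution D A 0 x u" unfolding u_def using Y(2)[OF x] by simp
    have u_le: "norm (u t) \<le> exp (\<omega>' * T) * norm x" if "0 \<le> t" "t \<le> T" for t
    proof -
      have "exp (\<omega> * (t - 0)) \<le> exp (\<omega>' * T)"
        using exp_le[OF that(1)] mult_left_mono[OF that(2) \<omega>'(1)] by (simp add: order_trans)
      then show ?thesis unfolding u_def
        using order_trans[OF norm_blinfun mult_right_mono[OF order_trans[OF evol_bd[OF that(1)]]]] by auto
    qed
    define \<kappa> where "\<kappa> = exp (\<omega>' * T) * (h * (G * h powr (\<beta> - \<alpha>) * (exp (\<omega>' * T) * norm x)))"
    have "norm (u (real M * h) - ?P M x) \<le> real M * (exp (\<omega>' * h) ^ M * \<kappa>)"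
    proof (rule discrete_gronwall[of "\<lambda>n. norm (u (real n * h) - ?P n x)"])
      show "norm (u (real 0 * h) - ?P 0 x) \<le> 0"
        using sol by (simp add: classical_solution_def)
      show "exp (\<omega>' * h) \<ge> 1" using \<omega>' h by simp
      show "\<kappa> \<ge> 0" using G0 h by (simp add: \<kappa>_def)
      fix k assume k: "k < M"
      define t where "t = real k * h"
      have t: "0 \<le> t" "t + h \<le> T"
      proof -
        have "real (Suc k) * h \<le> real M * h" using k h by (intro mult_right_mono) auto
        then show "t + h \<le> T" using h by (simp add: t_def algebra_simps)
      qed (use h in \<open>simp add: t_def\<close>)
      interpret F: resolvent_semigroup J D "A t" "S t" M0 \<omega>' by (rule sg)
      have "norm (u (t + h) - S t h (u t)) \<le> exp (\<omega>' * h) * (h * (G * h powr (\<beta> - \<alpha>) * norm (u t)))"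
      proof (rule frozen_step_error[OF sg])
        show "continuous_on {t..t + h} u"
          using sol t unfolding classical_solution_def by (auto elim: continuous_on_subset)
        show "u \<tau> \<in> D \<and> (u has_vector_derivative A \<tau> (u \<tau>)) (at \<tau>)" if "t < \<tau>" "\<tau> < t + h" for \<tau>
          using sol t that by (simp add: classical_solution_def)
        show "norm (A \<tau> (S t (\<tau> - t) (u t)) - A t (S t (\<tau> - t) (u t))) \<le> G * h powr (\<beta> - \<alpha>) * norm (u t)"
          if "t < \<tau>" "\<tau> < t + h" for \<tau>
          using that h by (intro pert) auto
      qed (use h G0 in auto)
      also have "\<dots> \<le> \<kappa>"
        unfolding \<kappa>_def using h(1) mult_left_mono[OF h(2) \<omega>'(1)] G0 t(1) u_le[of t] t(2)
        by (intro mult_mono mult_left_mono mult_nonneg_nonneg) auto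
      finally have local: "norm (u (t + h) - S t h (u t)) \<le> \<kappa>" .
      have "u (t + h) - S t h (?P k x) = S t h (u t - ?P k x) + (u (t + h) - S t h (u t))"
        by (simp add: blinfun.diff_right)
      then have "norm (u (t + h) - S t h (?P k x)) \<le> norm (S t h (u t - ?P k x)) + norm (u (t + h) - S t h (u t))"
        by (simp only: norm_triangle_ineq)
      also have "norm (S t h (u t - ?P k x)) \<le> exp (\<omega>' * h) * norm (u t - ?P k x)"
        using h by (intro F.norm_S_le) auto
      finally have "norm (u (t + h) - S t h (?P k x)) \<le> exp (\<omega>' * h) * norm (u t - ?P k x) + \<kappa>"
        using local by linarith
      then show "norm (u (real (Suc k) * h) - ?P (Suc k) x) \<le> exp (\<omega>' * h) * norm (u (real k * h) - ?P k x) + \<kappa>"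
        by (simp add: t_def algebra_simps)
    qed
    also have "exp (\<omega>' * h) ^ M = exp (\<omega>' * T)"
      using h(3) by (simp add: exp_of_nat_mult[symmetric] mult_ac)
    also have "real M * (exp (\<omega>' * T) * \<kappa>) = (real M * h) * exp (\<omega>' * T) * exp (\<omega>' * T) * exp (\<omega>' * T) * G * h powr (\<beta> - \<alpha>) * norm x"
      by (simp add: \<kappa>_def)
    finally show "norm ((U T 0 - prodL (\<lambda>k. S (real k * (T / real M)) (T / real M)) M) x)
        \<le> ?CT * (T / real M) powr (\<beta> - \<alpha>) * norm x"
      unfolding h(3) by (simp add: u_def blinfun.diff_left h_def)
  qed (use T G0 in simp)
qed

end
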